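(* Let $d\ge2$ be an integer, $\nu=d/2-1$, $R>0$ and $\alpha>0$. For $\ell=0,1,2,\dots$ put $\mu=\ell+\nu$ and $$\Delta_{\ell}(k)=\Delta_\ell(k;\alpha)=\Bigl(\alpha+\frac{\ell}{R}\Bigr)J_{\mu}(kR)-kJ_{\mu+1}(kR),\qquad k>0.$$ Then: 1. (Asymptotics as $k\to0^+$.) For $\ell=0$, $$\Delta_{0}(k)=\frac{(kR/2)^{\nu}}{\Gamma(\nu+1)}\Bigl[\alpha-\frac{\alpha+\frac{2}{R}}{4(\nu+1)}(kR)^{2}+\frac{\alpha R+4}{32R(\nu+1)(\nu+2)}(kR)^{4}+O(k^{6})\Bigr],$$ and for $\ell\ge1$, $$\Delta_{\ell}(k)=\frac{R^{\mu}}{2^{\mu}\Gamma(\mu+1)}\Bigl(\alpha+\frac{\ell}{R}\Bigr)k^{\mu}+O(k^{\mu+2}).$$ 2. (Low-frequency spectral gap.) There exists $k_c>0$ such that $\Delta_\ell(k)>0$ for all $0<k<k_c$ and all $\ell\ge0$. Consequently, the Robin Laplacian on $B_R(0)\subset\mathbb{R}^d$ has no eigenvalues in $(0,k_c^2)$; equivalently, no resonant modes exist in the wavenumber band $(0,k_c)$. 3. (Small-impedance estimate for the critical wavenumber.) Let $k_c$ be the largest number with the property in item 2 (the critical wavenumber, i.e. the smallest positive root of the functions $\Delta_\ell$, $\ell\ge0$). Put $\beta=\alpha R$ and $x_c=k_cR$. As $\beta\to0^+$, $$x_{c}^{2}=d\beta-\frac{d}{d+2}\,\beta^{2}+O(\beta^{3}),$$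 and hence, by truncating this expansion, for $\alpha R\lesssim1$, $$k_{c}\approx\sqrt{\frac{d\alpha}{R}\left(1-\frac{\alpha R}{d+2}\right)}.$$
   Context: $J_\mu$ is the Bessel function of the first kind of order $\mu$. The Robin Laplacian on the ball $B_R(0)$ is $-\Delta$ with boundary condition $\partial_n u+\alpha u=0$ on $\partial B_R(0)$, $n$ the outer unit normal. Resonant wavenumbers are the positive roots $k$ of $\Delta_\ell(k)=0$, $\ell=0,1,2,\dots$; the corresponding eigenvalues of the Robin Laplacian are $k^2$. The symbol $\approx$ in item 3 means the approximation obtained by dropping the $O(\beta^3)$ remainder in the preceding expansion. *)

theory Defs
  imports "HOL-Analysis.Analysis" "HOL-Library.Landau_Symbols"
begin

(* Ascending series of the Bessel function of the first kind of real order mu.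
   Meant for x > 0 only: because of "0 powr 0 = 0" it does not give J_0(0) = 1. *)
definition bessel_J :: "real \<Rightarrow> real \<Rightarrow> real" where
  "bessel_J \<mu> x =
     (\<Sum>m. (-1) ^ m / (fact m * Gamma (real m + \<mu> + 1)) * (x / 2) powr (2 * real m + \<mu>))"

definition robin_Delta :: "nat \<Rightarrow> real \<Rightarrow> real \<Rightarrow> nat \<Rightarrow> real \<Rightarrow> real" where
  "robin_Delta d R \<alpha> l k =
     (let \<mu> = real l + (real d / 2 - 1)
      in (\<alpha> + real l / R) * bessel_J \<mu> (k * R) - k * bessel_J (\<mu> + 1) (k * R))"

definition resonant_wavenumber :: "nat \<Rightarrow> real \<Rightarrow> real \<Rightarrow> real \<Rightarrow> bool" where
  "resonant_wavenumber d R \<alpha> k \<longleftrightarrow> 0 < k \<and> (\<exists>l. robin_Delta d R \<alpha> l k = 0)"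

definition positivity_band :: "nat \<Rightarrow> real \<Rightarrow> real \<Rightarrow> real \<Rightarrow> bool" where
  "positivity_band d R \<alpha> K \<longleftrightarrow>
     0 < K \<and> (\<forall>k l. 0 < k \<and> k < K \<longrightarrow> 0 < robin_Delta d R \<alpha> l k)"

definition critical_wavenumber :: "nat \<Rightarrow> real \<Rightarrow> real \<Rightarrow> real" where
  "critical_wavenumber d R \<alpha> = (GREATEST K. positivity_band d R \<alpha> K)"

(* The second directional derivatives are only meaningful for twice differentiable u;
   see C2_on. *)
definition laplacian :: "('a::euclidean_space \<Rightarrow> real) \<Rightarrow> 'a \<Rightarrow> real" where
  "laplacian u x = (\<Sum>b\<in>Basis. (deriv ^^ 2) (\<lambda>t. u (x + t *\<^sub>R b)) 0)"

definition gradient_on :: "('a::euclidean_space \<Rightarrow> real) \<Rightarrow> 'a set \<Rightarrow> ('a \<Rightarrow> 'a) \<Rightarrow> bool" where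
  "gradient_on u S g \<longleftrightarrow> (\<forall>x\<in>S. (u has_derivative (\<lambda>h. g x \<bullet> h)) (at x))"

definition C2_on :: "('a::euclidean_space \<Rightarrow> real) \<Rightarrow> 'a set \<Rightarrow> bool" where
  "C2_on u S \<longleftrightarrow>
     (\<exists>g. \<exists>H :: 'a \<Rightarrow> 'a \<Rightarrow>\<^sub>L 'a.
        gradient_on u S g \<and>
        (\<forall>x\<in>S. (g has_derivative blinfun_apply (H x)) (at x)) \<and> continuous_on S H)"

(* Classical eigenfunctions: u is C^2 in the open ball and C^1 up to the boundary, that is,
   the gradient in the open ball has a continuous extension g to the closed ball; the outer
   normal derivative at a boundary point x is then the inner product of g x with n = x / R. *)
definition robin_eigenfunction ::
    "real \<Rightarrow> real \<Rightarrow> real \<Rightarrow> ('a::euclidean_space \<Rightarrow> real) \<Rightarrow> bool" where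
  "robin_eigenfunction R \<alpha> lam u \<longleftrightarrow>
     C2_on u (ball 0 R) \<and> continuous_on (cball 0 R) u \<and>
     (\<exists>x\<in>ball 0 R. u x \<noteq> 0) \<and>
     (\<forall>x\<in>ball 0 R. - laplacian u x = lam * u x) \<and>
     (\<exists>g. gradient_on u (ball 0 R) g \<and> continuous_on (cball 0 R) g \<and>
          (\<forall>x\<in>sphere 0 R. g x \<bullet> (x /\<^sub>R R) + \<alpha> * u x = 0))"

definition robin_eigenvalue :: "'a::euclidean_space itself \<Rightarrow> real \<Rightarrow> real \<Rightarrow> real \<Rightarrow> bool" where
  "robin_eigenvalue _ R \<alpha> lam \<longleftrightarrow> (\<exists>u :: 'a \<Rightarrow> real. robin_eigenfunction R \<alpha> lam u)"

end

(*
With J_mu(x) = (x/2)^mu G_mu(x^2/4), G_mu entire, the sign of Delta_l(k) is that of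
D_l(s) = (beta + l) G_mu(s) - 2 s G_{mu+1}(s), where mu = l + nu, s = (kR)^2/4, beta = alpha R.
The relations G_mu' = -G_{mu+1} and G_mu = (mu + 1) G_{mu+1} - s G_{mu+2} carry the proof: as long
as D_0 > 0, all G_{nu+l} are positive and the quotients G_{mu+1}/G_mu decrease in mu (a Turan
inequality), so that D_l > 0 for every l. Hence the critical wavenumber comes from the first zero
of D_0, which exists by a Riccati argument and is expanded by means of the power series.

No spherical harmonics are needed to exclude eigenvalues k^2 below the critical value: for a
slightly larger k' the radial function G_nu(k'^2 |x|^2 / 4) is a positive strict supersolution of
the Robin problem, and the maximum of the quotient of an eigenfunction by it cannot be positive.
*)
theory Submission
  imports Defs
begin

section \<open>Power series, positivity and the first zero\<close>

text \<open>Nothing is known beforehand about the zeros of Bessel functions, and one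
  \<open>kc\<close> has to serve all orders \<open>l\<close>. Both obstacles are met by one
  principle: if a F + s F' > 0 on an interval starting at 0, then s^a F increases from 0, so F is
  positive. The definition of D_0 and the recurrence turn a F + s F' into a quantity already known
  to be positive. This is why D_0 > 0 is assumed on a whole interval (0, S) and not at one point.
  The radial function phi(x) = G_nu(kappa |x|^2) has R (d_n phi + alpha phi) = D_0(kappa R^2) on the
  sphere, so the condition that makes all D_l positive is also the boundary condition of a strict
  supersolution. In the variable s the first zero depends on R and alpha only through beta, so one
  remainder term serves all radii.\<close>

definition bessel_coeff :: "real \<Rightarrow> nat \<Rightarrow> real" where
  "bessel_coeff \<mu> m = (-1) ^ m / (fact m * Gamma (real m + \<mu> + 1))"

text \<open>This is the Bessel-Clifford function of order mu at -s, that is 0F1(; mu + 1; -s) /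
  Gamma(mu + 1). Unlike \<open>bessel_J\<close> it has its correct value at 0.\<close>

definition bessel_entire :: "real \<Rightarrow> real \<Rightarrow> real" where
  "bessel_entire \<mu> s = (\<Sum>m. bessel_coeff \<mu> m * s ^ m)"

lemma Gamma_plus1_real: "0 < x \<Longrightarrow> Gamma (x + 1) = x * Gamma (x::real)"
  by (rule Gamma_plus1) (auto elim!: nonpos_Ints_cases)

lemma bessel_coeff_abs_le:
  assumes "0 \<le> \<mu>"
  shows "\<bar>bessel_coeff \<mu> m\<bar> \<le> inverse (fact m) / Gamma (\<mu> + 1)"
proof -
  have "Gamma (\<mu> + 1) \<le> Gamma (real m + \<mu> + 1)"
  proof (induction m)
    case (Suc m)
    have "Gamma (real (Suc m) + \<mu> + 1) = (real m + \<mu> + 1) * Gamma (real m + \<mu> + 1)"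
      using Gamma_plus1_real[of "real m + \<mu> + 1"] assms by (simp add: add_ac)
    also have "\<dots> \<ge> 1 * Gamma (real m + \<mu> + 1)"
      using assms by (intro mult_right_mono) auto
    finally show ?case using Suc by simp
  qed simp
  moreover have "0 < Gamma (\<mu> + 1)" using assms by simp
  ultimately show ?thesis
    by (simp add: bessel_coeff_def abs_mult power_abs field_simps)
qed

lemma bessel_coeff_summable_abs:
  assumes "0 \<le> \<mu>"
  shows "summable (\<lambda>m. \<bar>bessel_coeff \<mu> m * s ^ m\<bar>)"
proof (rule summable_comparison_test')
  show "summable (\<lambda>m. inverse (fact m) * \<bar>s\<bar> ^ m / Gamma (\<mu> + 1))"
    by (intro summable_divide summable_exp)
  show "norm \<bar>bessel_coeff \<mu> m * s ^ m\<bar> \<le> inverse (fact m) * \<bar>s\<bar> ^ m / Gamma (\<mu> + 1)"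
    if "0 \<le> m" for m
    using mult_right_mono[OF bessel_coeff_abs_le[OF assms, of m], of "\<bar>s\<bar> ^ m"]
    by (simp add: abs_mult power_abs)
qed

lemma bessel_coeff_summable:
  "0 \<le> \<mu> \<Longrightarrow> summable (\<lambda>m. bessel_coeff \<mu> m * s ^ m)"
  by (rule summable_rabs_cancel[OF bessel_coeff_summable_abs])

text \<open>The factor m + 1 from differentiation cancels against (m + 1)!, and the shifted Gamma
  argument is that of order mu + 1; the extra factor -1 gives the sign.\<close>

lemma bessel_entire_has_derivative:
  assumes "0 \<le> \<mu>"
  shows "(bessel_entire \<mu> has_real_derivative - bessel_entire (\<mu> + 1) s) (at s)"
proof -
  have "diffs (bessel_coeff \<mu>) n = - bessel_coeff (\<mu> + 1) n" for n
    by (simp add: diffs_def bessel_coeff_def divide_simps del: of_nat_Suc) (simp add: add_ac)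
  moreover have "((\<lambda>x. \<Sum>n. bessel_coeff \<mu> n * x ^ n) has_real_derivative
      (\<Sum>n. diffs (bessel_coeff \<mu>) n * s ^ n)) (at s)"
    by (rule termdiffs_strong_converges_everywhere) (rule bessel_coeff_summable[OF assms])
  ultimately show ?thesis
    using assms bessel_coeff_summable[of "\<mu> + 1" s]
    by (simp add: bessel_entire_def[abs_def] suminf_minus)
qed

lemma bessel_entire_DERIV [derivative_intros]:
  assumes "0 \<le> \<mu>" "(f has_real_derivative f') (at x within A)"
  shows "((\<lambda>x. bessel_entire \<mu> (f x)) has_real_derivative - bessel_entire (\<mu> + 1) (f x) * f')
    (at x within A)"
  using DERIV_chain2[OF bessel_entire_has_derivative[OF assms(1)] assms(2)] .

lemma bessel_entire_continuous_on [continuous_intros]: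
  assumes "0 \<le> \<mu>" "continuous_on A f"
  shows "continuous_on A (\<lambda>x. bessel_entire \<mu> (f x))"
proof -
  have "continuous_on UNIV (bessel_entire \<mu>)"
    using bessel_entire_has_derivative[OF assms(1)] by (intro DERIV_continuous_on) auto
  then show ?thesis using assms(2) continuous_on_compose2 by blast
qed

text \<open>This is J_mu + J_{mu+2} = (2 (mu + 1) / x) J_{mu+1} divided by (x/2)^mu. It is checked
  coefficient by coefficient.\<close>

lemma bessel_entire_recurrence:
  assumes "0 \<le> \<mu>"
  shows "bessel_entire \<mu> s = (\<mu> + 1) * bessel_entire (\<mu> + 1) s - s * bessel_entire (\<mu> + 2) s"
proof -
  let ?c = bessel_coeff
  \<comment> \<open>The series of s G_{mu+2}, re-indexed by the power of s; the term at index 0 is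
    therefore 0.\<close>
  define b where "b m = (case m of 0 \<Rightarrow> 0 | Suc n \<Rightarrow> ?c (\<mu> + 2) n) * s ^ m" for m
  have b: "summable b"
  proof (subst summable_Suc_iff[symmetric])
    have "(\<lambda>n. b (Suc n)) = (\<lambda>n. s * (?c (\<mu> + 2) n * s ^ n))"
      by (auto simp: b_def)
    then show "summable (\<lambda>n. b (Suc n))"
      using bessel_coeff_summable[of "\<mu> + 2" s] assms by (simp add: summable_mult)
  qed
  have "suminf b = (\<Sum>n. b (Suc n)) + b 0"
    using suminf_split_head[OF b] by simp
  also have "(\<Sum>n. b (Suc n)) = s * bessel_entire (\<mu> + 2) s"
    using suminf_mult[OF bessel_coeff_summable[of "\<mu> + 2" s], of s] assms
    by (simp add: b_def bessel_entire_def mult_ac)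
  moreover have "b 0 = 0" by (simp add: b_def)
  ultimately have sb: "suminf b = s * bessel_entire (\<mu> + 2) s" by simp
  have eq: "?c \<mu> m * s ^ m = (\<mu> + 1) * (?c (\<mu> + 1) m * s ^ m) - b m" for m
  proof (cases m)
    case 0
    have "Gamma (\<mu> + 2) = (\<mu> + 1) * Gamma (\<mu> + 1)"
      using Gamma_plus1_real[of "\<mu> + 1"] assms by (simp add: add_ac)
    then show ?thesis using 0 assms by (simp add: b_def bessel_coeff_def add_ac)
  next
    case (Suc n)
    \<comment> \<open>With the common factor \<open>c\<close> the identity becomes 1 / m = (mu + 1)
      / (m x) + 1 / x, which is x = m + mu + 1.\<close>
    define x where "x = real m + \<mu> + 1"
    define c where "c = (-1) ^ m * s ^ m / (fact n * Gamma x)"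
    have x: "0 < x" "0 < Gamma x" using assms by (simp_all add: x_def)
    have fact: "fact m = real m * fact n" using Suc by simp
    have "real m \<noteq> 0" using Suc by simp
    have 1: "?c \<mu> m * s ^ m = c / real m"
      by (simp add: bessel_coeff_def c_def x_def fact)
    have "Gamma (real m + (\<mu> + 1) + 1) = x * Gamma x"
      using Gamma_plus1_real[OF x(1)] by (simp add: x_def add_ac)
    then have 2: "?c (\<mu> + 1) m * s ^ m = c / (real m * x)"
      by (simp add: bessel_coeff_def c_def fact mult_ac)
    have "Gamma (real n + (\<mu> + 2) + 1) = x * Gamma x"
      using Gamma_plus1_real[OF x(1)] Suc by (simp add: x_def add_ac)
    then have 3: "b m = - c / x"
      by (simp add: b_def Suc bessel_coeff_def c_def mult_ac)
    show ?thesis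
      unfolding 1 2 3 using x \<open>real m \<noteq> 0\<close>
      by (simp add: divide_simps) (simp add: x_def algebra_simps)
  qed
  have "bessel_entire \<mu> s = (\<Sum>m. (\<mu> + 1) * (?c (\<mu> + 1) m * s ^ m) - b m)"
    unfolding bessel_entire_def by (simp only: eq)
  also have "\<dots> = (\<mu> + 1) * bessel_entire (\<mu> + 1) s - suminf b"
    using bessel_coeff_summable[of "\<mu> + 1" s] assms b
    by (simp add: bessel_entire_def suminf_mult suminf_diff[symmetric] summable_mult)
  finally show ?thesis by (simp add: sb)
qed

lemma bessel_entire_0: "bessel_entire \<mu> 0 = 1 / Gamma (\<mu> + 1)"
  using powser_zero[of "bessel_coeff \<mu>"] by (simp add: bessel_entire_def bessel_coeff_def)

text \<open>On [0, 1] the power s^N can be taken out of the absolutely convergent tail, so the sum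
  of the absolute tail coefficients serves as \<open>C\<close>.\<close>

lemma bessel_entire_taylor:
  assumes "0 \<le> \<mu>"
  obtains C where "\<And>s. 0 \<le> s \<Longrightarrow> s \<le> 1 \<Longrightarrow>
    \<bar>bessel_entire \<mu> s - (\<Sum>m<N. bessel_coeff \<mu> m * s ^ m)\<bar> \<le> C * s ^ N"
proof
  let ?c = "bessel_coeff \<mu>"
  fix s :: real
  assume s: "0 \<le> s" "s \<le> 1"
  have sums: "summable (\<lambda>m. \<bar>?c m * t ^ m\<bar>)" for t
    by (rule bessel_coeff_summable_abs[OF assms])
  have sumN: "summable (\<lambda>m. \<bar>?c (m + N) * s ^ (m + N)\<bar>)"
    using summable_ignore_initial_segment[OF sums[of s], of N] .
  have sum1: "summable (\<lambda>m. \<bar>?c (m + N)\<bar>)"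
    using summable_ignore_initial_segment[OF sums[of 1], of N] by simp
  have "bessel_entire \<mu> s - (\<Sum>m<N. ?c m * s ^ m) = (\<Sum>m. ?c (m + N) * s ^ (m + N))"
    unfolding bessel_entire_def
    using suminf_split_initial_segment[OF bessel_coeff_summable[OF assms], of s N] by simp
  also have "\<bar>\<dots>\<bar> \<le> (\<Sum>m. \<bar>?c (m + N) * s ^ (m + N)\<bar>)"
    by (rule summable_rabs[OF sumN])
  also have "\<dots> \<le> (\<Sum>m. \<bar>?c (m + N)\<bar> * s ^ N)"
  proof (rule suminf_le[OF _ sumN summable_mult2[OF sum1]])
    fix m
    have "s ^ (m + N) \<le> s ^ N" using s by (intro power_decreasing) auto
    then show "\<bar>?c (m + N) * s ^ (m + N)\<bar> \<le> \<bar>?c (m + N)\<bar> * s ^ N"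
      using s by (simp add: abs_mult mult_left_mono)
  qed
  also have "\<dots> = (\<Sum>m. \<bar>?c (m + N)\<bar>) * s ^ N"
    by (rule suminf_mult2[OF sum1, symmetric])
  finally show "\<bar>bessel_entire \<mu> s - (\<Sum>m<N. ?c m * s ^ m)\<bar> \<le> (\<Sum>m. \<bar>?c (m + N)\<bar>) * s ^ N" .
qed

section \<open>From Bessel functions to the functions D_l\<close>

lemma bessel_J_eq_entire:
  assumes "0 \<le> \<mu>" "0 < x"
  shows "bessel_J \<mu> x = (x / 2) powr \<mu> * bessel_entire \<mu> (x\<^sup>2 / 4)"
proof -
  have "(x / 2) powr (2 * real m + \<mu>) = (x / 2) powr \<mu> * (x\<^sup>2 / 4) ^ m" for m
  proof -
    have "(x / 2) powr (2 * real m) = (x / 2) ^ (2 * m)"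
      using assms powr_realpow[of "x / 2" "2 * m"] by simp
    then show ?thesis by (simp add: powr_add power_mult power_divide)
  qed
  then have "bessel_J \<mu> x = (\<Sum>m. (x / 2) powr \<mu> * (bessel_coeff \<mu> m * (x\<^sup>2 / 4) ^ m))"
    by (simp add: bessel_J_def bessel_coeff_def mult_ac)
  then show ?thesis
    by (simp add: suminf_mult[OF bessel_coeff_summable[OF assms(1)]] bessel_entire_def)
qed

definition robin_entire :: "real \<Rightarrow> real \<Rightarrow> nat \<Rightarrow> real \<Rightarrow> real" where
  "robin_entire \<beta> \<nu> l s =
     (\<beta> + real l) * bessel_entire (real l + \<nu>) s - 2 * s * bessel_entire (real l + \<nu> + 1) s"

text \<open>The second term carries the additional factor k (k R / 2) = 2 s / R, and alpha + l / R =
  (beta + l) / R, so a positive prefactor splits off.\<close>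

lemma robin_Delta_eq_entire:
  assumes "2 \<le> d" "0 < R" "0 < k"
  shows "robin_Delta d R \<alpha> l k =
    (k * R / 2) powr (real l + (real d / 2 - 1)) / R *
      robin_entire (\<alpha> * R) (real d / 2 - 1) l ((k * R)\<^sup>2 / 4)"
proof -
  define \<mu> where "\<mu> = real l + (real d / 2 - 1)"
  have \<mu>: "0 \<le> \<mu>" using assms by (simp add: \<mu>_def)
  define P where "P = (k * R / 2) powr \<mu>"
  have "(k * R / 2) powr (\<mu> + 1) = P * (k * R / 2)"
    using assms by (simp add: powr_add P_def)
  then show ?thesis
    using assms \<mu> unfolding robin_Delta_def Let_def \<mu>_def[symmetric] robin_entire_def P_def[symmetric]
    by (simp add: bessel_J_eq_entire P_def[symmetric] divide_simps)
      (simp add: algebra_simps power2_eq_square)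
qed

lemma robin_Delta_pos_iff:
  assumes "2 \<le> d" "0 < R" "0 < k"
  shows "0 < robin_Delta d R \<alpha> l k \<longleftrightarrow>
    0 < robin_entire (\<alpha> * R) (real d / 2 - 1) l ((k * R)\<^sup>2 / 4)"
  using assms by (simp add: robin_Delta_eq_entire zero_less_mult_iff zero_less_divide_iff)

text \<open>The function \<open>s powr a * F s\<close> vanishes at \<open>0\<close> and has positive derivative.\<close>

lemma weighted_derivative_pos:
  fixes F :: "real \<Rightarrow> real"
  assumes "0 < a" "0 < S" "continuous_on {0..S} F"
    and F': "\<And>s. 0 < s \<Longrightarrow> s < S \<Longrightarrow> (F has_real_derivative F' s) (at s)"
    and pos: "\<And>s. 0 < s \<Longrightarrow> s < S \<Longrightarrow> 0 < a * F s + s * F' s"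
  shows "0 < F S"
proof -
  \<comment> \<open>Since \<open>0 powr a = 0\<close>, the left side vanishes and strict increase
    gives \<open>0 < S powr a * F S\<close>. Continuity at 0 comes from
    \<open>0 < a\<close>.\<close>
  have "0 powr a * F 0 < S powr a * F S"
  proof (rule DERIV_pos_imp_increasing_open[OF \<open>0 < S\<close>])
    fix s assume s: "0 < s" "s < S"
    have "((\<lambda>s. s powr a * F s) has_real_derivative
        a * s powr (a - 1) * F s + F' s * s powr a) (at s)"
      using DERIV_mult[OF has_real_derivative_powr[OF s(1)] F'[OF s]] .
    moreover have "a * s powr (a - 1) * F s + F' s * s powr a
        = s powr (a - 1) * (a * F s + s * F' s)"
      using s by (simp add: powr_diff field_simps)
    ultimately show "\<exists>y. ((\<lambda>s. s powr a * F s) has_real_derivative y) (at s) \<and> 0 < y"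
      using s pos[OF s] by auto
  next
    show "continuous_on {0..S} (\<lambda>s. s powr a * F s)"
      using assms by (intro continuous_on_mult continuous_on_powr' continuous_intros) auto
  qed
  then show ?thesis using assms by (simp add: zero_less_mult_iff)
qed

section \<open>Positivity at all orders\<close>

context
  fixes \<beta> \<nu> S :: real
  assumes \<beta>: "0 < \<beta>" and \<nu>: "0 \<le> \<nu>"
    and pos0: "\<And>s. 0 < s \<Longrightarrow> s < S \<Longrightarrow> 0 < robin_entire \<beta> \<nu> 0 s"
begin

text \<open>For the weight beta / 2 the combination a F + s F' is D_0 / 2. The endpoint s = S is
  included, which matters later when S is the first zero of D_0.\<close>

lemma bessel_entire_pos_base:
  assumes "0 < s" "s \<le> S"
  shows "0 < bessel_entire \<nu> s"
proof (rule weighted_derivative_pos[where a = "\<beta> / 2" and F = "bessel_entire \<nu>"])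
  show "(bessel_entire \<nu> has_real_derivative - bessel_entire (\<nu> + 1) t) (at t)" for t
    by (rule bessel_entire_has_derivative[OF \<nu>])
  show "0 < \<beta> / 2 * bessel_entire \<nu> t + t * - bessel_entire (\<nu> + 1) t" if "0 < t" "t < s" for t
    using pos0[of t] that assms by (simp add: robin_entire_def)
qed (use assms \<beta> \<nu> in \<open>auto intro!: continuous_intros\<close>)

text \<open>Induction on the order: by the recurrence, (mu + 1) G_{mu+1} + s G_{mu+1}' equals G_mu,
  which is positive by the induction hypothesis.\<close>

lemma bessel_entire_pos:
  assumes "0 < s" "s \<le> S"
  shows "0 < bessel_entire (real l + \<nu>) s"
  using assms
proof (induction l arbitrary: s)
  case 0
  then show ?case using bessel_entire_pos_base by simp
next
  case (Suc l)
  define \<mu> where "\<mu> = real l + \<nu>"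
  have \<mu>: "0 \<le> \<mu>" using \<nu> by (simp add: \<mu>_def)
  have "0 < bessel_entire (\<mu> + 1) s"
  proof (rule weighted_derivative_pos[where a = "\<mu> + 1" and F = "bessel_entire (\<mu> + 1)"])
    show "(bessel_entire (\<mu> + 1) has_real_derivative - bessel_entire (\<mu> + 2) t) (at t)" for t
      using bessel_entire_has_derivative[of "\<mu> + 1" t] \<mu> by (simp add: add_ac)
    show "0 < (\<mu> + 1) * bessel_entire (\<mu> + 1) t + t * - bessel_entire (\<mu> + 2) t"
      if "0 < t" "t < s" for t
      using Suc.IH[of t] bessel_entire_recurrence[OF \<mu>, of t] that Suc.prems
      by (simp add: \<mu>_def)
  qed (use Suc.prems \<mu> in \<open>auto intro!: continuous_intros\<close>)
  then show ?case by (simp add: \<mu>_def add_ac)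
qed

text \<open>A Turan type inequality: by the recurrence,
  \<open>T = G\<^sub>\<mu>\<^sub>+\<^sub>1\<^sup>2 - G\<^sub>\<mu> G\<^sub>\<mu>\<^sub>+\<^sub>2\<close> satisfies
  \<open>(\<mu> + 2) T + s T' = G\<^sub>\<mu>\<^sub>+\<^sub>1\<^sup>2\<close>.\<close>

lemma bessel_entire_turan:
  fixes l :: nat
  assumes "0 < s" "s \<le> S"
  defines "\<mu> \<equiv> real l + \<nu>"
  shows "bessel_entire \<mu> s * bessel_entire (\<mu> + 2) s < (bessel_entire (\<mu> + 1) s)\<^sup>2"
proof -
  let ?G = bessel_entire
  have \<mu>: "0 \<le> \<mu>" using \<nu> by (simp add: \<mu>_def)
  define T where "T t = (?G (\<mu> + 1) t)\<^sup>2 - ?G \<mu> t * ?G (\<mu> + 2) t" for t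
  define T' where "T' t = ?G \<mu> t * ?G (\<mu> + 3) t - ?G (\<mu> + 1) t * ?G (\<mu> + 2) t" for t
  have "0 < T s"
  proof (rule weighted_derivative_pos[where a = "\<mu> + 2" and F = T and F' = T'])
    show "(T has_real_derivative T' t) (at t)" for t
      unfolding T_def[abs_def] T'_def using \<mu>
      by (auto intro!: derivative_eq_intros simp: add_ac algebra_simps)
    fix t assume t: "0 < t" "t < s"
    \<comment> \<open>Substituting both relations leaves s T' = (mu + 2) G_mu G_{mu+2} - (mu + 1)
      G_{mu+1}^2, which explains the weight mu + 2.\<close>
    have r1: "t * ?G (\<mu> + 3) t = (\<mu> + 2) * ?G (\<mu> + 2) t - ?G (\<mu> + 1) t"
      using bessel_entire_recurrence[of "\<mu> + 1" t] \<mu> by (simp add: add_ac)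
    have r2: "t * ?G (\<mu> + 2) t = (\<mu> + 1) * ?G (\<mu> + 1) t - ?G \<mu> t"
      using bessel_entire_recurrence[of \<mu> t] \<mu> by simp
    have "t * T' t = ?G \<mu> t * (t * ?G (\<mu> + 3) t) - ?G (\<mu> + 1) t * (t * ?G (\<mu> + 2) t)"
      by (simp add: T'_def algebra_simps)
    then have "(\<mu> + 2) * T t + t * T' t = (?G (\<mu> + 1) t)\<^sup>2"
      unfolding r1 r2 T_def by (simp add: algebra_simps power2_eq_square)
    moreover have "0 < ?G (\<mu> + 1) t"
      using bessel_entire_pos[of t "Suc l"] t assms by (simp add: add_ac)
    ultimately show "0 < (\<mu> + 2) * T t + t * T' t" by simp
  qed (use assms \<mu> in \<open>auto simp: T_def intro!: continuous_intros\<close>)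
  then show ?thesis by (simp add: T_def)
qed

text \<open>The Turan inequality makes the quotient of consecutive functions decrease in the order,
  which reduces the claim to \<open>l = 0\<close>.\<close>

lemma robin_entire_pos:
  assumes s: "0 < s" "s < S"
  shows "0 < robin_entire \<beta> \<nu> l s"
proof -
  \<comment> \<open>Divided by G_mu > 0, the claim D_l > 0 reads 2 s q_l < beta + l. The left side
    does not increase with l and the right side grows, so l = 0 is the worst case.\<close>
  define q where "q l = bessel_entire (real l + \<nu> + 1) s / bessel_entire (real l + \<nu>) s" for l
  have G: "0 < bessel_entire (real l + \<nu>) s" for l
    using bessel_entire_pos s by simp
  have "q (Suc l) \<le> q l" for l
    using bessel_entire_turan[of s l] s G[of l] G[of "Suc l"]
    by (simp add: q_def divide_simps power2_eq_square add_ac mult_ac)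
  then have "q l \<le> q 0" using lift_Suc_antimono_le[of q 0 l] by simp
  then have "2 * s * q l \<le> 2 * s * q 0" using s by simp
  also have "\<dots> < \<beta>"
    using pos0[OF s] G[of 0] by (simp add: q_def robin_entire_def field_simps)
  finally have "2 * s * q l < \<beta> + real l" by simp
  then show ?thesis
    using G[of l] by (simp add: q_def robin_entire_def field_simps)
qed

end

section \<open>Existence of the first zero of D_0\<close>

lemma robin_entire_continuous_on [continuous_intros]:
  assumes "0 \<le> \<nu>" "continuous_on A f"
  shows "continuous_on A (\<lambda>x. robin_entire \<beta> \<nu> l (f x))"
  unfolding robin_entire_def using assms by (intro continuous_intros) auto

text \<open>With \<open>h = G\<^sub>\<nu>\<^sub>+\<^sub>1 / G\<^sub>\<nu>\<close>, the function
  \<open>s h\<close> has derivative \<open>1 - \<nu> h + s h\<^sup>2\<close>, which is at least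
  \<open>1 / 2\<close> for \<open>s \<ge> \<nu>\<^sup>2 / 2\<close>, so \<open>s h\<close> cannot stay below \<open>\<beta> / 2\<close>.\<close>

lemma robin_entire_nonpos_somewhere:
  assumes \<beta>: "0 < \<beta>" and \<nu>: "0 \<le> \<nu>"
  shows "\<exists>s>0. robin_entire \<beta> \<nu> 0 s \<le> 0"
proof (rule ccontr)
  assume "\<not> ?thesis"
  then have pos0: "0 < robin_entire \<beta> \<nu> 0 s" if "0 < s" for s
    using that by force
  define G where "G l s = bessel_entire (real l + \<nu>) s" for l :: nat and s
  have G: "0 < G l s" if "0 < s" for l s
    unfolding G_def using that pos0
    by (intro bessel_entire_pos[where \<beta> = \<beta> and S = s]) (auto simp: \<beta> \<nu>)
  define p where "p s = s * G 1 s / G 0 s" for s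
  have p_lt: "p s < \<beta> / 2" if "0 < s" for s
    using pos0[OF that] G[OF that, of 0] that
    by (simp add: p_def robin_entire_def G_def add_ac field_simps)
  have deriv: "\<exists>D\<ge>1/2. (p has_real_derivative D) (at s)" if s: "0 < s" "\<nu>\<^sup>2 / 2 \<le> s" for s
  proof -
    define h where "h = G 1 s / G 0 s"
    have r: "s * G 2 s = (\<nu> + 1) * G 1 s - G 0 s"
      using bessel_entire_recurrence[OF \<nu>, of s] by (simp add: G_def add_ac)
    have "((G 1 s - s * G 2 s) * G 0 s + s * G 1 s * G 1 s) / (G 0 s)\<^sup>2
        = 1 - \<nu> * h + s * h\<^sup>2"
      unfolding r h_def using G[OF s(1), of 0]
      by (simp add: power2_eq_square divide_simps) (simp add: algebra_simps)
    then have "(p has_real_derivative 1 - \<nu> * h + s * h\<^sup>2) (at s)"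
      unfolding p_def[abs_def] G_def using \<nu> G[OF s(1), of 0]
      by (auto intro!: derivative_eq_intros simp: add_ac algebra_simps power2_eq_square G_def)
    \<comment> \<open>Completing the square bounds the slope of \<open>p\<close> from below without
      any knowledge of \<open>h\<close>.\<close>
    moreover have "1 - \<nu> * h + s * h\<^sup>2 = s * (h - \<nu> / (2 * s))\<^sup>2 + (1 - \<nu>\<^sup>2 / (4 * s))"
      using s by (simp add: power2_eq_square divide_simps) (simp add: algebra_simps)
    moreover have "\<nu>\<^sup>2 / (4 * s) \<le> 1 / 2" using s by (simp add: field_simps)
    moreover have "0 \<le> s * (h - \<nu> / (2 * s))\<^sup>2" using s by simp
    ultimately have "1 / 2 \<le> 1 - \<nu> * h + s * h\<^sup>2" by linarith
    then show ?thesis using \<open>(p has_real_derivative 1 - \<nu> * h + s * h\<^sup>2) (at s)\<close> by blast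
  qed
  \<comment> \<open>The summand 1 keeps \<open>A\<close> positive also for nu = 0.\<close>
  define A where "A = \<nu>\<^sup>2 / 2 + 1"
  have A: "0 < A" by (simp add: A_def add_nonneg_pos)
  have "\<exists>D z. A < z \<and> z < A + \<beta> \<and> (p has_real_derivative D) (at z)
      \<and> p (A + \<beta>) - p A = (A + \<beta> - A) * D"
  proof (rule MVT)
    show "continuous_on {A..A + \<beta>} p"
    proof (rule DERIV_atLeastAtMost_imp_continuous_on)
      fix x assume "A \<le> x" "x \<le> A + \<beta>"
      then show "\<exists>y. (p has_real_derivative y) (at x)"
        using deriv[of x] A by (auto simp: A_def)
    qed
    show "p differentiable at x" if "A < x" "x < A + \<beta>" for x
      using deriv[of x] that A by (auto simp: A_def real_differentiable_def)
  qed (use \<beta> in simp)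
  then obtain z D where z: "A < z" "(p has_real_derivative D) (at z)" "p (A + \<beta>) - p A = \<beta> * D"
    by auto
  have "1 / 2 \<le> D"
    using deriv[of z] z A DERIV_unique by (fastforce simp: A_def)
  \<comment> \<open>Slope at least 1/2 over an interval of length beta lifts \<open>p\<close> by
    beta / 2, the bound it should stay below.\<close>
  then have "\<beta> * (1 / 2) \<le> \<beta> * D" using \<beta> by (intro mult_left_mono) auto
  moreover have "0 < p A" unfolding p_def using A G by simp
  ultimately have "\<beta> / 2 < p (A + \<beta>)" using z by simp
  then show False using p_lt[of "A + \<beta>"] A \<beta> by simp
qed

lemma robin_entire_first_zero:
  assumes \<beta>: "0 < \<beta>" and \<nu>: "0 \<le> \<nu>"
  shows "\<exists>s>0. robin_entire \<beta> \<nu> 0 s = 0 \<and> (\<forall>t. 0 < t \<and> t < s \<longrightarrow> 0 < robin_entire \<beta> \<nu> 0 t)"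
proof -
  let ?D = "robin_entire \<beta> \<nu> 0"
  define Z where "Z = {s. 0 \<le> s \<and> ?D s \<le> 0}"
  have cont: "continuous_on A ?D" for A
    using \<nu> by (intro continuous_intros)
  have "closed Z"
    unfolding Z_def by (intro closed_Collect_conj closed_Collect_le continuous_intros cont \<nu>)
  moreover have "Z \<noteq> {}" "bdd_below Z"
    using robin_entire_nonpos_somewhere[OF assms] by (auto simp: Z_def intro: less_imp_le bdd_belowI)
  ultimately have Inf: "Inf Z \<in> Z" by (intro closed_contains_Inf)
  have D0: "0 < ?D 0" using \<beta> \<nu> by (simp add: robin_entire_def bessel_entire_0)
  define s where "s = Inf Z"
  have s: "0 < s" "?D s \<le> 0" using Inf D0 by (auto simp: Z_def s_def less_le)
  have pos: "0 < ?D t" if "0 < t" "t < s" for t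
    using cInf_lower[OF _ \<open>bdd_below Z\<close>, of t] that by (force simp: Z_def s_def)
  \<comment> \<open>The infimum gives only a nonpositive value at \<open>s\<close>. The intermediate
    value theorem gives a zero in [0, s], and positivity before \<open>s\<close> forces it to be
    \<open>s\<close>.\<close>
  have "\<exists>x\<ge>0. x \<le> s \<and> ?D x = 0"
    using IVT2'[of ?D s 0 0] s D0 cont by auto
  then obtain x where x: "0 \<le> x" "x \<le> s" "?D x = 0" by blast
  then have "x = s" using pos[of x] D0 by (cases "x = 0"; cases "x < s") auto
  then show ?thesis using x s pos by blast
qed

section \<open>Critical wavenumber and asymptotics\<close>

text \<open>\<open>s\<close> corresponds to k = 2 sqrt s / R. The band is open at its right end, so
  the zero of Delta_0 at this k does not spoil the band ending there but bars every longer one;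
  hence \<open>GREATEST\<close> is attained.\<close>

lemma critical_wavenumber_of_first_zero:
  assumes "2 \<le> d" "0 < R" "0 < \<alpha>" and \<nu>: "\<nu> = real d / 2 - 1" and s: "0 < s"
    and zero: "robin_entire (\<alpha> * R) \<nu> 0 s = 0"
    and pos: "\<And>t. 0 < t \<Longrightarrow> t < s \<Longrightarrow> 0 < robin_entire (\<alpha> * R) \<nu> 0 t"
  shows "critical_wavenumber d R \<alpha> = 2 * sqrt s / R"
    and "positivity_band d R \<alpha> (2 * sqrt s / R)"
    and "positivity_band d R \<alpha> K \<Longrightarrow> K \<le> 2 * sqrt s / R"
    and "resonant_wavenumber d R \<alpha> (2 * sqrt s / R)"
    and "resonant_wavenumber d R \<alpha> k \<Longrightarrow> 2 * sqrt s / R \<le> k"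
proof -
  define kc where "kc = 2 * sqrt s / R"
  have kc: "0 < kc" "(kc * R)\<^sup>2 / 4 = s"
    using s assms by (simp_all add: kc_def power_mult_distrib)
  have \<nu>0: "0 \<le> \<nu>" using assms by simp
  have band: "positivity_band d R \<alpha> kc"
    unfolding positivity_band_def
  proof (intro conjI allI impI kc(1))
    fix k l assume k: "0 < k \<and> k < kc"
    have "(k * R)\<^sup>2 < (kc * R)\<^sup>2" using k assms by (intro power_strict_mono) auto
    then have "(k * R)\<^sup>2 / 4 < s" using kc by simp
    moreover have "0 < (k * R)\<^sup>2 / 4" using k \<open>0 < R\<close> by simp
    moreover have "0 < \<alpha> * R" using \<open>0 < R\<close> \<open>0 < \<alpha>\<close> by simp
    ultimately have "0 < robin_entire (\<alpha> * R) \<nu> l ((k * R)\<^sup>2 / 4)"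
      using robin_entire_pos[of "\<alpha> * R" \<nu> s "(k * R)\<^sup>2 / 4" l] pos \<nu>0 by blast
    then show "0 < robin_Delta d R \<alpha> l k"
      using assms k by (simp add: robin_Delta_pos_iff)
  qed
  have zero': "robin_Delta d R \<alpha> 0 kc = 0"
    using robin_Delta_eq_entire[of d R kc \<alpha> 0] assms kc zero by simp
  have le: "K \<le> kc" if "positivity_band d R \<alpha> K" for K
    using that kc(1) zero' unfolding positivity_band_def by (metis less_irrefl not_less)
  show "critical_wavenumber d R \<alpha> = 2 * sqrt s / R"
    unfolding critical_wavenumber_def kc_def[symmetric]
    using band le by (rule Greatest_equality)
  show "positivity_band d R \<alpha> (2 * sqrt s / R)"
    using band by (simp add: kc_def)
  show "K \<le> 2 * sqrt s / R" if "positivity_band d R \<alpha> K"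
    using le[OF that] by (simp add: kc_def)
  show "resonant_wavenumber d R \<alpha> (2 * sqrt s / R)"
    using zero' kc(1) unfolding resonant_wavenumber_def kc_def by blast
  show "2 * sqrt s / R \<le> k" if "resonant_wavenumber d R \<alpha> k"
    using that band unfolding resonant_wavenumber_def positivity_band_def kc_def[symmetric]
    by (metis less_irrefl not_less)
qed

section \<open>Taylor estimates and asymptotics for small k\<close>

lemma bessel_entire_taylor_3:
  assumes "0 \<le> \<nu>"
  obtains C where "\<And>s. 0 \<le> s \<Longrightarrow> s \<le> 1 \<Longrightarrow>
    \<bar>Gamma (\<nu> + 1) * bessel_entire \<nu> s - (1 - s / (\<nu> + 1) + s\<^sup>2 / (2 * (\<nu> + 1) * (\<nu> + 2)))\<bar> \<le> C * s ^ 3"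
proof -
  define \<Gamma> where "\<Gamma> = Gamma (\<nu> + 1)"
  have \<Gamma>: "0 < \<Gamma>" using assms by (simp add: \<Gamma>_def)
  have g2: "Gamma (\<nu> + 2) = (\<nu> + 1) * \<Gamma>"
    using Gamma_plus1_real[of "\<nu> + 1"] assms by (simp add: \<Gamma>_def add_ac)
  have g3: "Gamma (\<nu> + 3) = (\<nu> + 2) * ((\<nu> + 1) * \<Gamma>)"
    using Gamma_plus1_real[of "\<nu> + 2"] assms unfolding g2 by (simp add: add_ac)
  obtain C where C: "\<And>s. 0 \<le> s \<Longrightarrow> s \<le> 1 \<Longrightarrow>
    \<bar>bessel_entire \<nu> s - (\<Sum>m<3. bessel_coeff \<nu> m * s ^ m)\<bar> \<le> C * s ^ 3"
    using bessel_entire_taylor[OF assms] by blast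
  have sum: "\<Gamma> * (\<Sum>m<3. bessel_coeff \<nu> m * s ^ m)
      = 1 - s / (\<nu> + 1) + s\<^sup>2 / (2 * (\<nu> + 1) * (\<nu> + 2))" for s
  proof -
    have "\<Gamma> * (1 / (c * \<Gamma>)) = 1 / c" for c using \<Gamma> by simp
    from this[of 1] this[of "\<nu> + 1"] this[of "2 * (\<nu> + 1) * (\<nu> + 2)"]
    have "\<Gamma> * (1 / \<Gamma> + - 1 / ((\<nu> + 1) * \<Gamma>) * s + 1 / (2 * (\<nu> + 1) * (\<nu> + 2) * \<Gamma>) * s\<^sup>2)
        = 1 - s / (\<nu> + 1) + s\<^sup>2 / (2 * (\<nu> + 1) * (\<nu> + 2))"
      using \<Gamma> by (simp add: distrib_left right_diff_distrib)
    moreover have "(\<Sum>m<3. bessel_coeff \<nu> m * s ^ m) = 1 / \<Gamma> + - 1 / ((\<nu> + 1) * \<Gamma>) * s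
        + 1 / (2 * (\<nu> + 1) * (\<nu> + 2) * \<Gamma>) * s\<^sup>2"
    proof -
      have "bessel_coeff \<nu> 0 = 1 / \<Gamma>" by (simp add: bessel_coeff_def \<Gamma>_def)
      moreover have "bessel_coeff \<nu> 1 = - 1 / ((\<nu> + 1) * \<Gamma>)"
        unfolding g2[symmetric] by (simp add: bessel_coeff_def add_ac)
      moreover have "2 * (\<nu> + 1) * (\<nu> + 2) * \<Gamma> = 2 * Gamma (\<nu> + 3)"
        unfolding g3 by (simp only: mult_ac)
      then have "bessel_coeff \<nu> 2 = 1 / (2 * (\<nu> + 1) * (\<nu> + 2) * \<Gamma>)"
        by (simp add: bessel_coeff_def add_ac)
      ultimately show ?thesis by (simp add: numeral_3_eq_3 numeral_2_eq_2)
    qed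
    ultimately show ?thesis by simp
  qed
  show ?thesis
  proof (rule that)
    fix s :: real assume s: "0 \<le> s" "s \<le> 1"
    have "\<bar>\<Gamma> * bessel_entire \<nu> s - \<Gamma> * (\<Sum>m<3. bessel_coeff \<nu> m * s ^ m)\<bar>
        = \<Gamma> * \<bar>bessel_entire \<nu> s - (\<Sum>m<3. bessel_coeff \<nu> m * s ^ m)\<bar>"
      using \<Gamma> by (simp add: right_diff_distrib[symmetric] abs_mult)
    also have "\<dots> \<le> \<Gamma> * (C * s ^ 3)"
      using C[OF s] \<Gamma> by (intro mult_left_mono) auto
    finally show "\<bar>Gamma (\<nu> + 1) * bessel_entire \<nu> s
        - (1 - s / (\<nu> + 1) + s\<^sup>2 / (2 * (\<nu> + 1) * (\<nu> + 2)))\<bar> \<le> (\<Gamma> * C) * s ^ 3"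
      unfolding sum \<Gamma>_def[symmetric] by (simp only: mult_ac)
  qed
qed

text \<open>\<open>C\<close> is independent of beta, so the estimate serves both for fixed beta as k
  tends to 0 and along the first zero as beta tends to 0. The factor 2 s gains one order, so
  G_{nu+1} is expanded only to first order.\<close>

lemma robin_entire_0_taylor:
  assumes "0 \<le> \<nu>"
  obtains C where "0 \<le> C" "\<And>\<beta> s. 0 \<le> \<beta> \<Longrightarrow> 0 \<le> s \<Longrightarrow> s \<le> 1 \<Longrightarrow>
    \<bar>Gamma (\<nu> + 1) * robin_entire \<beta> \<nu> 0 s -
      (\<beta> * (1 - s / (\<nu> + 1) + s\<^sup>2 / (2 * (\<nu> + 1) * (\<nu> + 2)))
        - 2 * s * (1 / (\<nu> + 1) - s / ((\<nu> + 1) * (\<nu> + 2))))\<bar> \<le> C * (\<beta> + 1) * s ^ 3"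
proof -
  define \<Gamma> where "\<Gamma> = Gamma (\<nu> + 1)"
  have \<Gamma>: "0 < \<Gamma>" using assms by (simp add: \<Gamma>_def)
  have g2: "Gamma (\<nu> + 2) = (\<nu> + 1) * \<Gamma>"
    using Gamma_plus1_real[of "\<nu> + 1"] assms by (simp add: \<Gamma>_def add_ac)
  obtain C1 where C1: "\<And>s. 0 \<le> s \<Longrightarrow> s \<le> 1 \<Longrightarrow>
    \<bar>\<Gamma> * bessel_entire \<nu> s - (1 - s / (\<nu> + 1) + s\<^sup>2 / (2 * (\<nu> + 1) * (\<nu> + 2)))\<bar> \<le> C1 * s ^ 3"
    using bessel_entire_taylor_3[OF assms] unfolding \<Gamma>_def by blast
  obtain C2 where C2: "\<And>s. 0 \<le> s \<Longrightarrow> s \<le> 1 \<Longrightarrow>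
    \<bar>Gamma (\<nu> + 2) * bessel_entire (\<nu> + 1) s - (1 - s / (\<nu> + 2) + s\<^sup>2 / (2 * (\<nu> + 2) * (\<nu> + 3)))\<bar>
      \<le> C2 * s ^ 3"
    using bessel_entire_taylor_3[of "\<nu> + 1"] assms by (auto simp: add_ac)
  show ?thesis
  proof (rule that)
    define C where "C = max \<bar>C1\<bar> (2 * (\<bar>C2\<bar> + 1))"
    show "0 \<le> C" by (simp add: C_def)
    fix \<beta> s :: real assume \<beta>: "0 \<le> \<beta>" and s: "0 \<le> s" "s \<le> 1"
    define p where "p = 1 - s / (\<nu> + 1) + s\<^sup>2 / (2 * (\<nu> + 1) * (\<nu> + 2))"
    define q where "q = 1 - s / (\<nu> + 2)"
    have "\<bar>\<Gamma> * bessel_entire \<nu> s - p\<bar> \<le> \<bar>C1\<bar> * s ^ 3"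
      using C1[OF s] mult_right_mono[OF abs_ge_self[of C1], of "s ^ 3"] s by (simp add: p_def)
    also have "\<dots> \<le> C * s ^ 3" using s by (intro mult_right_mono) (auto simp: C_def)
    finally have P: "\<bar>\<beta> * (\<Gamma> * bessel_entire \<nu> s - p)\<bar> \<le> \<beta> * (C * s ^ 3)"
      using \<beta> by (simp add: abs_mult mult_left_mono)
    have s3: "s ^ 3 \<le> s\<^sup>2" using s by (intro power_decreasing) auto
    \<comment> \<open>The quadratic term of G_{nu+1} is moved into the remainder. Its coefficient is
      at most 1, which is the 1 in \<open>\<bar>C2\<bar> + 1\<close>.\<close>
    have "1 * 1 \<le> 2 * (\<nu> + 2) * (\<nu> + 3)"
      using assms by (intro mult_mono) auto
    then have "s\<^sup>2 / (2 * (\<nu> + 2) * (\<nu> + 3)) \<le> s\<^sup>2 / 1"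
      using assms by (intro divide_left_mono) auto
    moreover have "0 \<le> s\<^sup>2 / (2 * (\<nu> + 2) * (\<nu> + 3))" using assms by simp
    moreover have "C2 * s ^ 3 \<le> \<bar>C2\<bar> * s\<^sup>2" using s s3 by (intro mult_mono) auto
    ultimately have "\<bar>Gamma (\<nu> + 2) * bessel_entire (\<nu> + 1) s - q\<bar> \<le> (\<bar>C2\<bar> + 1) * s\<^sup>2"
      using C2[OF s] by (simp add: q_def abs_le_iff algebra_simps)
    then have "2 * s * \<bar>Gamma (\<nu> + 2) * bessel_entire (\<nu> + 1) s - q\<bar> \<le> 2 * s * ((\<bar>C2\<bar> + 1) * s\<^sup>2)"
      using s by (intro mult_left_mono) auto
    also have "\<dots> = 2 * (\<bar>C2\<bar> + 1) * s ^ 3" by (simp add: power2_eq_square power3_eq_cube)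
    also have "\<dots> \<le> C * s ^ 3" using s by (intro mult_right_mono) (auto simp: C_def)
    finally have "2 * s * \<bar>Gamma (\<nu> + 2) * bessel_entire (\<nu> + 1) s - q\<bar> / (\<nu> + 1) \<le> C * s ^ 3 / (\<nu> + 1)"
      using assms by (intro divide_right_mono) auto
    also have "\<dots> \<le> C * s ^ 3"
      using assms s \<open>0 \<le> C\<close> divide_left_mono[of 1 "\<nu> + 1" "C * s ^ 3"] by simp
    finally have Q: "\<bar>2 * s / (\<nu> + 1) * (Gamma (\<nu> + 2) * bessel_entire (\<nu> + 1) s - q)\<bar> \<le> C * s ^ 3"
      using s assms by (simp add: abs_mult)
    have "\<Gamma> * robin_entire \<beta> \<nu> 0 s - (\<beta> * p - 2 * s * (1 / (\<nu> + 1) - s / ((\<nu> + 1) * (\<nu> + 2))))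
      = \<beta> * (\<Gamma> * bessel_entire \<nu> s - p)
        - 2 * s / (\<nu> + 1) * (Gamma (\<nu> + 2) * bessel_entire (\<nu> + 1) s - q)"
      unfolding g2 robin_entire_def q_def using assms
      by (simp add: divide_simps) (simp add: algebra_simps)
    also have "\<bar>\<dots>\<bar> \<le> \<beta> * (C * s ^ 3) + C * s ^ 3"
      by (rule order_trans[OF abs_triangle_ineq4 add_mono[OF P Q]])
    also have "\<dots> = C * (\<beta> + 1) * s ^ 3" by (simp add: algebra_simps)
    finally show "\<bar>Gamma (\<nu> + 1) * robin_entire \<beta> \<nu> 0 s -
      (\<beta> * (1 - s / (\<nu> + 1) + s\<^sup>2 / (2 * (\<nu> + 1) * (\<nu> + 2)))
        - 2 * s * (1 / (\<nu> + 1) - s / ((\<nu> + 1) * (\<nu> + 2))))\<bar> \<le> C * (\<beta> + 1) * s ^ 3"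
      unfolding \<Gamma>_def[symmetric] p_def[symmetric] .
  qed
qed

lemma robin_Delta_0_asymptotics:
  assumes "2 \<le> d" "0 < R" "0 < \<alpha>" and \<nu>: "\<nu> = real d / 2 - 1"
  shows "\<exists>\<rho> \<in> O[at_right 0](\<lambda>k. k ^ 6). \<forall>k>0.
        robin_Delta d R \<alpha> 0 k =
          (k * R / 2) powr \<nu> / Gamma (\<nu> + 1) *
          (\<alpha> - (\<alpha> + 2 / R) / (4 * (\<nu> + 1)) * (k * R) ^ 2
             + (\<alpha> * R + 4) / (32 * R * (\<nu> + 1) * (\<nu> + 2)) * (k * R) ^ 4 + \<rho> k)"
proof -
  have \<nu>0: "0 \<le> \<nu>" using assms by simp
  define \<beta> where "\<beta> = \<alpha> * R"
  have \<beta>: "0 < \<beta>" using assms by (simp add: \<beta>_def)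
  define \<Gamma> where "\<Gamma> = Gamma (\<nu> + 1)"
  have \<Gamma>: "0 < \<Gamma>" using \<nu>0 by (simp add: \<Gamma>_def)
  define p where "p k = \<alpha> - (\<alpha> + 2 / R) / (4 * (\<nu> + 1)) * (k * R) ^ 2
             + (\<alpha> * R + 4) / (32 * R * (\<nu> + 1) * (\<nu> + 2)) * (k * R) ^ 4" for k
  define \<rho> where "\<rho> k = \<Gamma> / R * robin_entire \<beta> \<nu> 0 ((k * R)\<^sup>2 / 4) - p k" for k
  obtain C where C: "0 \<le> C" "\<And>s. 0 \<le> s \<Longrightarrow> s \<le> 1 \<Longrightarrow>
    \<bar>\<Gamma> * robin_entire \<beta> \<nu> 0 s -
      (\<beta> * (1 - s / (\<nu> + 1) + s\<^sup>2 / (2 * (\<nu> + 1) * (\<nu> + 2)))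
        - 2 * s * (1 / (\<nu> + 1) - s / ((\<nu> + 1) * (\<nu> + 2))))\<bar> \<le> C * (\<beta> + 1) * s ^ 3"
    using robin_entire_0_taylor[OF \<nu>0] \<beta> unfolding \<Gamma>_def by (metis less_imp_le)
  \<comment> \<open>The two s^2 terms add up to (beta + 4) / (2 (nu + 1) (nu + 2)), and s^2 = (k
    R)^4 / 16 produces the constant 32.\<close>
  have p: "R * p k = \<beta> * (1 - s / (\<nu> + 1) + s\<^sup>2 / (2 * (\<nu> + 1) * (\<nu> + 2)))
        - 2 * s * (1 / (\<nu> + 1) - s / ((\<nu> + 1) * (\<nu> + 2)))" if "s = (k * R)\<^sup>2 / 4" for s k
  proof -
    have 2: "(k * R) ^ 2 = 4 * s" using that by simp
    have "(k * R) ^ 4 = ((k * R) ^ 2) ^ 2" by (simp flip: power_mult)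
    then have 4: "(k * R) ^ 4 = 16 * s\<^sup>2" unfolding 2 by (simp add: power_mult_distrib)
    show ?thesis
      unfolding p_def 4 2 \<beta>_def using \<open>0 < R\<close> \<nu>0
      by (simp add: divide_simps) (simp add: algebra_simps power2_eq_square)
  qed
  have "\<rho> \<in> O[at_right 0](\<lambda>k. k ^ 6)"
  proof (rule bigoI)
    \<comment> \<open>The bound k < 2 / R ensures s <= 1, the range of the Taylor estimate.\<close>
    have "\<bar>\<rho> k\<bar> \<le> C * (\<beta> + 1) * R ^ 5 / 64 * k ^ 6" if k: "0 < k" "k < 2 / R" for k
    proof -
      define s where "s = (k * R)\<^sup>2 / 4"
      have "k * R \<le> 2" using k \<open>0 < R\<close> by (simp add: field_simps)
      then have "(k * R)\<^sup>2 \<le> 2\<^sup>2" using k \<open>0 < R\<close> by (intro power_mono) auto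
      then have s: "0 \<le> s" "s \<le> 1" by (simp_all add: s_def)
      have "R * \<bar>\<rho> k\<bar> = \<bar>R * \<rho> k\<bar>" using \<open>0 < R\<close> by (simp add: abs_mult)
      also have "R * \<rho> k = \<Gamma> * robin_entire \<beta> \<nu> 0 s - R * p k"
        using \<open>0 < R\<close> by (simp add: \<rho>_def s_def right_diff_distrib)
      also have "\<bar>\<dots>\<bar> \<le> C * (\<beta> + 1) * s ^ 3"
        unfolding p[OF s_def] by (rule C(2)[OF s])
      also have "s ^ 3 = R * (R ^ 5 / 64 * k ^ 6)"
        by (simp add: s_def power_divide power_mult_distrib eval_nat_numeral)
      finally have "R * \<bar>\<rho> k\<bar> \<le> R * (C * (\<beta> + 1) * R ^ 5 / 64 * k ^ 6)"
        by (simp add: mult_ac)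
      then show ?thesis using \<open>0 < R\<close> by simp
    qed
    then show "\<forall>\<^sub>F k in at_right 0. norm (\<rho> k) \<le> (C * (\<beta> + 1) * R ^ 5 / 64) * norm (k ^ 6)"
      using \<open>0 < R\<close> unfolding eventually_at_right_field
      by (intro exI[of _ "2 / R"]) auto
  qed
  moreover have "robin_Delta d R \<alpha> 0 k = (k * R / 2) powr \<nu> / \<Gamma> * (p k + \<rho> k)" if "0 < k" for k
    using robin_Delta_eq_entire[of d R k \<alpha> 0] assms that \<Gamma> by (simp add: \<rho>_def \<beta>_def)
  ultimately show ?thesis unfolding p_def \<Gamma>_def by blast
qed

text \<open>Only the constant term 1 / Gamma(mu + 1) of G_mu contributes to leading order; the rest
  of G_mu and all of 2 s G_{mu+1} are O(s) = O(k^2).\<close>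

lemma robin_Delta_asymptotics:
  assumes "2 \<le> d" "0 < R" "0 < \<alpha>" and \<mu>: "\<mu> = real l + (real d / 2 - 1)"
  shows "(\<lambda>k. robin_Delta d R \<alpha> l k
              - R powr \<mu> / (2 powr \<mu> * Gamma (\<mu> + 1)) * (\<alpha> + real l / R) * k powr \<mu>)
          \<in> O[at_right 0](\<lambda>k. k powr (\<mu> + 2))"
proof -
  have \<mu>0: "0 \<le> \<mu>" using assms by simp
  obtain C1 where C1: "\<And>s. 0 \<le> s \<Longrightarrow> s \<le> 1 \<Longrightarrow> \<bar>bessel_entire \<mu> s - 1 / Gamma (\<mu> + 1)\<bar> \<le> C1 * s"
    using bessel_entire_taylor[OF \<mu>0, of 1] by (auto simp: bessel_coeff_def)
  \<comment> \<open>The Taylor estimate with no terms is a plain bound on [0, 1].\<close>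
  obtain C2 where C2: "\<And>s. 0 \<le> s \<Longrightarrow> s \<le> 1 \<Longrightarrow> \<bar>bessel_entire (\<mu> + 1) s\<bar> \<le> C2"
    using bessel_entire_taylor[of "\<mu> + 1" 0] \<mu>0 by auto
  define b where "b = \<alpha> * R + real l"
  have b: "0 < b" using assms by (simp add: b_def add_pos_nonneg)
  define C where "C = b * C1 + 2 * C2"
  show ?thesis
  proof (rule bigoI)
    have "\<bar>robin_Delta d R \<alpha> l k - R powr \<mu> / (2 powr \<mu> * Gamma (\<mu> + 1)) * (\<alpha> + real l / R) * k powr \<mu>\<bar>
      \<le> (R / 2) powr \<mu> * R / 4 * C * k powr (\<mu> + 2)" if k: "0 < k" "k < 2 / R" for k
    proof -
      define s where "s = (k * R)\<^sup>2 / 4"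
      have "k * R \<le> 2" using k \<open>0 < R\<close> by (simp add: field_simps)
      then have "(k * R)\<^sup>2 \<le> 2\<^sup>2" using k \<open>0 < R\<close> by (intro power_mono) auto
      then have s: "0 \<le> s" "s \<le> 1" by (simp_all add: s_def)
      define P where "P = (k * R / 2) powr \<mu>"
      have P: "0 \<le> P" by (simp add: P_def)
      have P_eq: "P = R powr \<mu> * k powr \<mu> / 2 powr \<mu>"
        using k \<open>0 < R\<close> by (simp add: P_def powr_mult powr_divide)
      have "robin_Delta d R \<alpha> l k = P / R * robin_entire (\<alpha> * R) (real d / 2 - 1) l s"
        using robin_Delta_eq_entire[of d R k \<alpha> l] assms(1,2) k by (simp add: P_def s_def \<mu>)
      moreover have "R powr \<mu> / (2 powr \<mu> * Gamma (\<mu> + 1)) * (\<alpha> + real l / R) * k powr \<mu>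
        = P / Gamma (\<mu> + 1) * (\<alpha> + real l / R)"
        by (simp add: P_eq)
      ultimately have "robin_Delta d R \<alpha> l k - R powr \<mu> / (2 powr \<mu> * Gamma (\<mu> + 1)) * (\<alpha> + real l / R) * k powr \<mu>
        = P / R * robin_entire (\<alpha> * R) (real d / 2 - 1) l s - P / Gamma (\<mu> + 1) * (\<alpha> + real l / R)"
        by simp
      also have "\<dots> = P / R * (b * (bessel_entire \<mu> s - 1 / Gamma (\<mu> + 1)) - 2 * s * bessel_entire (\<mu> + 1) s)"
        unfolding robin_entire_def \<mu>[symmetric] b_def
        using \<open>0 < R\<close> \<mu>0 less_imp_neq[OF Gamma_real_pos[of "\<mu> + 1"]]
        by (simp add: divide_simps) (simp add: algebra_simps)
      finally have eq: "\<bar>robin_Delta d R \<alpha> l k - R powr \<mu> / (2 powr \<mu> * Gamma (\<mu> + 1)) * (\<alpha> + real l / R) * k powr \<mu>\<bar>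
        = P / R * \<bar>b * (bessel_entire \<mu> s - 1 / Gamma (\<mu> + 1)) - 2 * s * bessel_entire (\<mu> + 1) s\<bar>"
        using P \<open>0 < R\<close> by (simp add: abs_mult)
      have "\<bar>b * (bessel_entire \<mu> s - 1 / Gamma (\<mu> + 1)) - 2 * s * bessel_entire (\<mu> + 1) s\<bar>
        \<le> b * \<bar>bessel_entire \<mu> s - 1 / Gamma (\<mu> + 1)\<bar> + 2 * s * \<bar>bessel_entire (\<mu> + 1) s\<bar>"
        using b s by (intro order_trans[OF abs_triangle_ineq4]) (simp add: abs_mult)
      also have "\<dots> \<le> b * (C1 * s) + 2 * s * C2"
        using b s by (intro add_mono mult_left_mono C1 C2) auto
      also have "\<dots> = C * s" by (simp add: C_def algebra_simps)
      finally have "P / R * \<bar>b * (bessel_entire \<mu> s - 1 / Gamma (\<mu> + 1)) - 2 * s * bessel_entire (\<mu> + 1) s\<bar>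
        \<le> P / R * (C * s)"
        using P \<open>0 < R\<close> by (intro mult_left_mono) auto
      also have "\<dots> = (R / 2) powr \<mu> * R / 4 * C * k powr (\<mu> + 2)"
        using k \<open>0 < R\<close>
        by (simp add: P_eq s_def powr_add powr_divide power_mult_distrib power2_eq_square)
      finally show ?thesis by (simp only: eq)
    qed
    then show "\<forall>\<^sub>F k in at_right 0.
        norm (robin_Delta d R \<alpha> l k - R powr \<mu> / (2 powr \<mu> * Gamma (\<mu> + 1)) * (\<alpha> + real l / R) * k powr \<mu>)
        \<le> ((R / 2) powr \<mu> * R / 4 * C) * norm (k powr (\<mu> + 2))"
      using \<open>0 < R\<close> unfolding eventually_at_right_field
      by (intro exI[of _ "2 / R"]) auto
  qed
qed

section \<open>Expansion of the first zero for small beta\<close>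

text \<open>Follows from \<open>(\<nu> + 1) G\<^sub>\<nu>\<^sub>+\<^sub>1 - G\<^sub>\<nu> = s G\<^sub>\<nu>\<^sub>+\<^sub>2 > 0\<close>.\<close>

lemma robin_entire_first_zero_le:
  assumes \<beta>: "0 < \<beta>" and \<nu>: "0 \<le> \<nu>" and s: "0 < s" "robin_entire \<beta> \<nu> 0 s = 0"
    and pos: "\<And>t. 0 < t \<Longrightarrow> t < s \<Longrightarrow> 0 < robin_entire \<beta> \<nu> 0 t"
  shows "s \<le> (\<nu> + 1) / 2 * \<beta>"
proof -
  have G: "0 < bessel_entire (real l + \<nu>) s" for l
    by (rule bessel_entire_pos[OF \<beta> \<nu> pos s(1) order_refl])
  have "0 < s * bessel_entire (\<nu> + 2) s" using G[of 2] s(1) by (simp add: add_ac)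
  then have "bessel_entire \<nu> s < (\<nu> + 1) * bessel_entire (\<nu> + 1) s"
    using bessel_entire_recurrence[OF \<nu>, of s] by simp
  then have "\<beta> * bessel_entire \<nu> s < \<beta> * ((\<nu> + 1) * bessel_entire (\<nu> + 1) s)"
    using \<beta> by simp
  then have "2 * s * bessel_entire (\<nu> + 1) s < \<beta> * (\<nu> + 1) * bessel_entire (\<nu> + 1) s"
    using s(2) by (simp add: robin_entire_def)
  moreover have "0 < bessel_entire (\<nu> + 1) s" using G[of 1] by (simp add: add_ac)
  ultimately have "2 * s < \<beta> * (\<nu> + 1)" by simp
  then show ?thesis by (simp add: mult.commute)
qed

text \<open>A bootstrap: z = O(beta) makes the truncated equation hold up to O(beta^3); solving it
  for z gives z = a beta / 2 + O(beta^2), and inserting this in the quadratic terms gives the next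
  order. For nu = d/2 - 1 one has a = d/2.\<close>

lemma robin_entire_first_zero_asymptotics:
  fixes z :: "real \<Rightarrow> real"
  assumes \<nu>: "0 \<le> \<nu>"
    and z: "\<And>\<beta>. 0 < \<beta> \<Longrightarrow> 0 < z \<beta>" "\<And>\<beta>. 0 < \<beta> \<Longrightarrow> robin_entire \<beta> \<nu> 0 (z \<beta>) = 0"
    and pos: "\<And>\<beta> t. 0 < \<beta> \<Longrightarrow> 0 < t \<Longrightarrow> t < z \<beta> \<Longrightarrow> 0 < robin_entire \<beta> \<nu> 0 t"
  defines "a \<equiv> \<nu> + 1"
  shows "(\<lambda>\<beta>. 4 * z \<beta> - (2 * a * \<beta> - a / (a + 1) * \<beta>\<^sup>2)) \<in> O[at_right 0](\<lambda>\<beta>. \<beta> ^ 3)"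
proof -
  have a: "0 < a" using \<nu> by (simp add: a_def)
  let ?F = "at_right (0::real)"
  have z_le: "z \<beta> \<le> a / 2 * \<beta>" if "0 < \<beta>" for \<beta>
    using robin_entire_first_zero_le[OF that \<nu> z(1)[OF that] z(2)[OF that] pos[OF that]]
    by (simp add: a_def)
  have Oz: "z \<in> O[?F](\<lambda>\<beta>. \<beta>)"
  proof (rule bigoI)
    show "\<forall>\<^sub>F \<beta> in ?F. norm (z \<beta>) \<le> (a / 2) * norm \<beta>"
      unfolding eventually_at_right_field
      using z(1) z_le by (intro exI[of _ 1]) (auto simp: less_imp_le abs_of_pos)
  qed
  \<comment> \<open>The Taylor polynomial of Gamma(nu + 1) D_0 at the zero. As D_0 vanishes there,
    \<open>E\<close> is the negative of the Taylor remainder.\<close>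
  define E where "E \<beta> = \<beta> * (1 - z \<beta> / a + (z \<beta>)\<^sup>2 / (2 * a * (a + 1)))
        - 2 * z \<beta> * (1 / a - z \<beta> / (a * (a + 1)))" for \<beta>
  obtain C where C: "0 \<le> C" "\<And>\<beta> s. 0 \<le> \<beta> \<Longrightarrow> 0 \<le> s \<Longrightarrow> s \<le> 1 \<Longrightarrow>
    \<bar>Gamma (\<nu> + 1) * robin_entire \<beta> \<nu> 0 s -
      (\<beta> * (1 - s / (\<nu> + 1) + s\<^sup>2 / (2 * (\<nu> + 1) * (\<nu> + 2)))
        - 2 * s * (1 / (\<nu> + 1) - s / ((\<nu> + 1) * (\<nu> + 2))))\<bar> \<le> C * (\<beta> + 1) * s ^ 3"
    using robin_entire_0_taylor[OF \<nu>] by metis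
  have OE: "E \<in> O[?F](\<lambda>\<beta>. \<beta> ^ 3)"
  proof -
    have "\<bar>E \<beta>\<bar> \<le> C * 2 * \<bar>z \<beta> ^ 3\<bar>" if \<beta>: "0 < \<beta>" "\<beta> < min 1 (2 / a)" for \<beta>
    proof -
      have "a / 2 * \<beta> \<le> 1" using \<beta> a by (simp add: field_simps)
      then have z1: "0 \<le> z \<beta>" "z \<beta> \<le> 1" using z_le[of \<beta>] z(1)[of \<beta>] \<beta> by auto
      have "\<bar>E \<beta>\<bar> \<le> C * (\<beta> + 1) * z \<beta> ^ 3"
        using C(2)[of \<beta> "z \<beta>"] z1 \<beta> z(2)[of \<beta>] by (simp add: E_def a_def add_ac)
      also have "\<dots> \<le> C * 2 * z \<beta> ^ 3"
        using z1 \<beta> C(1) by (intro mult_right_mono mult_left_mono) auto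
      finally show ?thesis using z1 by simp
    qed
    then have "E \<in> O[?F](\<lambda>\<beta>. z \<beta> ^ 3)"
      using a unfolding eventually_at_right_field
      by (intro bigoI[of _ "C * 2"]) (auto simp: eventually_at_right_field intro!: exI[of _ "min 1 (2 / a)"])
    also have "(\<lambda>\<beta>. z \<beta> ^ 3) \<in> O[?F](\<lambda>\<beta>. \<beta> ^ 3)"
      using Oz by (rule landau_o.big_power)
    finally show ?thesis .
  qed
  define \<delta> where "\<delta> \<beta> = z \<beta> - a / 2 * \<beta>" for \<beta>
  have O_bz: "(\<lambda>\<beta>. \<beta> * z \<beta>) \<in> O[?F](\<lambda>\<beta>. \<beta>\<^sup>2)"
    using landau_o.big_mult[OF landau_o.big_refl Oz, of "\<lambda>\<beta>. \<beta>"] by (simp add: power2_eq_square)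
  have O_zz: "(\<lambda>\<beta>. z \<beta> * z \<beta>) \<in> O[?F](\<lambda>\<beta>. \<beta>\<^sup>2)"
    using landau_o.big_mult[OF Oz Oz] by (simp add: power2_eq_square)
  have O_bzz: "(\<lambda>\<beta>. \<beta> * (z \<beta> * z \<beta>)) \<in> O[?F](\<lambda>\<beta>. \<beta> ^ 3)"
    using landau_o.big_mult[OF landau_o.big_refl O_zz, of "\<lambda>\<beta>. \<beta>"]
    by (simp add: power2_eq_square power3_eq_cube mult_ac)
  have O32: "(\<lambda>\<beta>. \<beta> ^ 3) \<in> O[?F](\<lambda>\<beta>. \<beta>\<^sup>2)"
  proof (rule bigoI)
    show "\<forall>\<^sub>F \<beta> in ?F. norm (\<beta> ^ 3) \<le> 1 * norm (\<beta>\<^sup>2)"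
      unfolding eventually_at_right_field
      by (intro exI[of _ 1]) (auto intro!: power_decreasing)
  qed
  have a_ne: "a + 1 \<noteq> 0" "4 * a + 4 \<noteq> 0" using a by auto
  \<comment> \<open>Multiplying \<open>E\<close> by a / 2 isolates the linear term z.\<close>
  have "\<delta> = (\<lambda>\<beta>. - 1 / 2 * (\<beta> * z \<beta>) + 1 / (a + 1) * (z \<beta> * z \<beta>)
      + 1 / (4 * (a + 1)) * (\<beta> * (z \<beta> * z \<beta>)) - a / 2 * E \<beta>)"
    unfolding \<delta>_def E_def using a
    by (auto simp: fun_eq_iff divide_simps) (auto simp: algebra_simps power2_eq_square)
  also have "\<dots> \<in> O[?F](\<lambda>\<beta>. \<beta>\<^sup>2)"
    using a_ne O_bz O_zz landau_o.big_trans[OF O_bzz O32] landau_o.big_trans[OF OE O32]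
    by (intro sum_in_bigo) simp_all
  finally have O\<delta>: "\<delta> \<in> O[?F](\<lambda>\<beta>. \<beta>\<^sup>2)" .
  have O_bd: "(\<lambda>\<beta>. \<beta> * \<delta> \<beta>) \<in> O[?F](\<lambda>\<beta>. \<beta> ^ 3)"
    using landau_o.big_mult[OF landau_o.big_refl O\<delta>, of "\<lambda>\<beta>. \<beta>"]
    by (simp add: power2_eq_square power3_eq_cube mult_ac)
  have O_zd: "(\<lambda>\<beta>. z \<beta> * \<delta> \<beta>) \<in> O[?F](\<lambda>\<beta>. \<beta> ^ 3)"
    using landau_o.big_mult[OF Oz O\<delta>]
    by (simp add: power2_eq_square power3_eq_cube mult_ac)
  \<comment> \<open>Four times the previous identity, with z = a beta / 2 + delta inserted in beta z
    and z z. The coefficients -a and a^2 / (a + 1) of beta^2 add up to -a / (a + 1).\<close>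
  have "(\<lambda>\<beta>. 4 * z \<beta> - (2 * a * \<beta> - a / (a + 1) * \<beta>\<^sup>2)) =
     (\<lambda>\<beta>. - 2 * (\<beta> * \<delta> \<beta>) + 4 / (a + 1) * (z \<beta> * \<delta> \<beta>) + 2 * a / (a + 1) * (\<beta> * \<delta> \<beta>)
      + 1 / (a + 1) * (\<beta> * (z \<beta> * z \<beta>)) - 2 * a * E \<beta>)"
    unfolding \<delta>_def E_def using a
    by (auto simp: fun_eq_iff divide_simps) (auto simp: algebra_simps power2_eq_square)
  also have "\<dots> \<in> O[?F](\<lambda>\<beta>. \<beta> ^ 3)"
    using a_ne O_bd O_zd O_bzz OE by (intro sum_in_bigo) simp_all
  finally show ?thesis .
qed

section \<open>Eigenvalues of the Robin Laplacian\<close>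

lemma gradient_on_line_derivative:
  assumes "gradient_on u S g" "x + t *\<^sub>R b \<in> S"
  shows "((\<lambda>t. u (x + t *\<^sub>R b)) has_real_derivative g (x + t *\<^sub>R b) \<bullet> b) (at t)"
proof -
  have "(u has_derivative (\<lambda>h. g (x + t *\<^sub>R b) \<bullet> h)) (at (x + t *\<^sub>R b))"
    using assms by (simp add: gradient_on_def)
  moreover have "((\<lambda>t. x + t *\<^sub>R b) has_derivative (\<lambda>h. h *\<^sub>R b)) (at t)"
    by (auto intro!: derivative_eq_intros)
  ultimately have "((\<lambda>t. u (x + t *\<^sub>R b)) has_derivative (\<lambda>h. g (x + t *\<^sub>R b) \<bullet> (h *\<^sub>R b))) (at t)"
    by (rule has_derivative_compose[rotated])
  then show ?thesis by (simp add: has_field_derivative_def mult.commute[of _ "g _ \<bullet> b"] mult_commute_abs)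
qed

lemma inner_line_derivative:
  assumes "(g has_derivative H) (at (x + t *\<^sub>R b))"
  shows "((\<lambda>t. g (x + t *\<^sub>R b) \<bullet> b) has_real_derivative H b \<bullet> b) (at t)"
proof -
  have "((\<lambda>t. x + t *\<^sub>R b) has_derivative (\<lambda>h. h *\<^sub>R b)) (at t)"
    by (auto intro!: derivative_eq_intros)
  from this assms have "((\<lambda>t. g (x + t *\<^sub>R b)) has_derivative (\<lambda>h. H (h *\<^sub>R b))) (at t)"
    by (rule has_derivative_compose)
  then have "((\<lambda>t. g (x + t *\<^sub>R b) \<bullet> b) has_derivative (\<lambda>h. H (h *\<^sub>R b) \<bullet> b)) (at t)"
    by (rule has_derivative_inner_left)
  moreover have "H (h *\<^sub>R b) = h *\<^sub>R H b" for h
    using has_derivative_linear[OF assms] by (simp add: linear_cmul)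
  ultimately show ?thesis by (simp add: has_field_derivative_def mult_commute_abs)
qed

text \<open>The inner \<open>deriv\<close> has to be known near 0, not only at 0, before the outer
  one can be evaluated; openness of \<open>S\<close> provides this neighbourhood.\<close>

lemma laplacian_eq_trace:
  fixes u :: "'a::euclidean_space \<Rightarrow> real"
  assumes "gradient_on u S g" "open S" "x \<in> S" "(g has_derivative H) (at x)"
  shows "laplacian u x = (\<Sum>b\<in>Basis. H b \<bullet> b)"
  unfolding laplacian_def
proof (rule sum.cong[OF refl])
  fix b :: 'a assume "b \<in> Basis"
  have "isCont (\<lambda>t. x + t *\<^sub>R b) 0" by (intro continuous_intros)
  then have "eventually (\<lambda>t. x + t *\<^sub>R b \<in> S) (nhds 0)"
    using assms(2,3) by (auto simp: isCont_def tendsto_nhds_iff dest!: topological_tendstoD intro: eventually_nhds_conv_at[THEN iffD2])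
  then have "eventually (\<lambda>t. deriv (\<lambda>t. u (x + t *\<^sub>R b)) t = g (x + t *\<^sub>R b) \<bullet> b) (nhds 0)"
    by (rule eventually_mono) (rule DERIV_imp_deriv[OF gradient_on_line_derivative[OF assms(1)]])
  then have "deriv (deriv (\<lambda>t. u (x + t *\<^sub>R b))) 0 = deriv (\<lambda>t. g (x + t *\<^sub>R b) \<bullet> b) 0"
    by (rule deriv_cong_ev) simp
  also have "\<dots> = H b \<bullet> b"
    using inner_line_derivative[of g H x 0 b] assms(4) by (intro DERIV_imp_deriv) simp
  finally show "(deriv ^^ 2) (\<lambda>t. u (x + t *\<^sub>R b)) 0 = H b \<bullet> b"
    by (simp add: numeral_2_eq_2)
qed

text \<open>If D > 0, then f' is positive just to the right of its zero at 0, and f rises above its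
  maximum.\<close>

lemma second_derivative_local_max:
  fixes f :: "real \<Rightarrow> real"
  assumes "0 < e" and max: "\<And>t. \<bar>t\<bar> < e \<Longrightarrow> f t \<le> f 0"
    and f': "\<And>t. \<bar>t\<bar> < e \<Longrightarrow> (f has_real_derivative f' t) (at t)"
    and f'': "(f' has_real_derivative D) (at 0)"
  shows "D \<le> 0"
proof (rule ccontr)
  assume "\<not> D \<le> 0"
  then obtain d where d: "0 < d" "\<And>h. 0 < h \<Longrightarrow> h < d \<Longrightarrow> f' 0 < f' h"
    using DERIV_pos_inc_right[OF f''] by auto
  have "f' 0 = 0"
    using DERIV_local_max[OF f'[of 0] \<open>0 < e\<close>] max \<open>0 < e\<close> by auto
  define t where "t = min d e / 2"
  have t: "0 < t" "t < d" "t < e" using d \<open>0 < e\<close> by (auto simp: t_def)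
  have "f 0 < f t"
  proof (rule DERIV_pos_imp_increasing_open[OF t(1)])
    show "\<exists>y. (f has_real_derivative y) (at x) \<and> 0 < y" if "0 < x" "x < t" for x
      using f'[of x] d(2)[of x] that t \<open>f' 0 = 0\<close> by auto
    show "continuous_on {0..t} f"
      using f' t by (intro DERIV_atLeastAtMost_imp_continuous_on) (force simp: abs_if)
  qed
  then show False using max[of t] t by auto
qed

text \<open>Suited to the boundary condition, where the gradient on the sphere is only a continuous
  extension: differentiability of \<open>f\<close> at \<open>b\<close> is not assumed. A negative
  \<open>F b\<close> would make \<open>f\<close> strictly decreasing just before
  \<open>b\<close>.\<close>

lemma end_derivative_nonneg:
  fixes f F :: "real \<Rightarrow> real"
  assumes "a < b" "continuous_on {a..b} f" "continuous_on {a..b} F"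
    and F: "\<And>t. a < t \<Longrightarrow> t < b \<Longrightarrow> (f has_real_derivative F t) (at t)"
    and max: "\<And>t. a \<le> t \<Longrightarrow> t \<le> b \<Longrightarrow> f t \<le> f b"
  shows "0 \<le> F b"
proof (rule ccontr)
  assume "\<not> 0 \<le> F b"
  moreover have "(F \<longlongrightarrow> F b) (at b within {a..b})"
    using assms by (simp add: continuous_on_def)
  ultimately have "eventually (\<lambda>t. F t < 0) (at b within {a..b})"
    by (auto intro: order_tendstoD(2))
  then obtain e where e: "0 < e" "\<And>t. t \<in> {a..b} \<Longrightarrow> t \<noteq> b \<Longrightarrow> dist t b < e \<Longrightarrow> F t < 0"
    by (auto simp: eventually_at)
  define c where "c = max a (b - e)"
  have c: "a \<le> c" "c < b" "b - e \<le> c" using e \<open>a < b\<close> by (auto simp: c_def)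
  have "f b < f c"
  proof (rule DERIV_neg_imp_decreasing_open[OF c(2)])
    show "\<exists>y. (f has_real_derivative y) (at x) \<and> y < 0" if "c < x" "x < b" for x
      using F[of x] e(2)[of x] that c by (auto simp: dist_real_def)
    show "continuous_on {c..b} f"
      using assms(2) c by (elim continuous_on_subset) auto
  qed
  then show False using max[of c] c by simp
qed

section \<open>Comparison with the radial supersolution\<close>

text \<open>A positive maximum \<open>M\<close> of \<open>u / \<phi>\<close>, where \<open>\<phi> x = G\<^sub>\<nu> (\<kappa> \<bar>x\<bar>\<^sup>2)\<close> solves
  \<open>- \<Delta> \<phi> = 4 \<kappa> \<phi>\<close>, makes \<open>M \<phi>\<close> touch \<open>u\<close> from above. In the interior this contradicts
  \<open>lam < 4 \<kappa>\<close>, on the sphere it contradicts \<open>\<partial>\<^sub>n \<phi> + \<alpha> \<phi> > 0\<close>.\<close>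

lemma robin_comparison_principle:
  fixes u :: "'a::euclidean_space \<Rightarrow> real"
  assumes \<nu>: "\<nu> = real DIM('a) / 2 - 1" "0 \<le> \<nu>" and "0 < R" "0 < \<kappa>" "lam < 4 * \<kappa>"
    and posG: "\<And>s. 0 \<le> s \<Longrightarrow> s \<le> \<kappa> * R\<^sup>2 \<Longrightarrow> 0 < bessel_entire \<nu> s"
    and posD: "0 < robin_entire (\<alpha> * R) \<nu> 0 (\<kappa> * R\<^sup>2)"
    and u: "gradient_on u (ball 0 R) g" "continuous_on (cball 0 R) u"
    and H: "\<And>x. x \<in> ball 0 R \<Longrightarrow> (g has_derivative H x) (at x)"
    and eq: "\<And>x. x \<in> ball 0 R \<Longrightarrow> - (\<Sum>b\<in>Basis. H x b \<bullet> b) = lam * u x"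
    and g2: "gradient_on u (ball 0 R) g2" "continuous_on (cball 0 R) g2"
    and bc: "\<And>x. x \<in> sphere 0 R \<Longrightarrow> g2 x \<bullet> (x /\<^sub>R R) + \<alpha> * u x = 0"
    and y: "y \<in> cball 0 R"
  shows "u y \<le> 0"
proof (rule ccontr)
  assume uy: "\<not> u y \<le> 0"
  let ?G = "bessel_entire"
  define \<phi> where "\<phi> x = ?G \<nu> (\<kappa> * (norm x)\<^sup>2)" for x :: 'a
  have \<phi>: "0 < \<phi> x" if "x \<in> cball 0 R" for x
    unfolding \<phi>_def using that \<open>0 < \<kappa>\<close> \<open>0 < R\<close> by (intro posG) (auto intro!: mult_left_mono power_mono)
  have "continuous_on (cball 0 R) (\<lambda>x. u x / \<phi> x)"
    using u(2) \<phi> unfolding \<phi>_def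
    by (intro continuous_intros \<nu>(2)) (force simp: \<phi>_def)+
  then obtain x0 where x0: "x0 \<in> cball 0 R"
    and sup: "\<And>x. x \<in> cball 0 R \<Longrightarrow> u x / \<phi> x \<le> u x0 / \<phi> x0"
    using continuous_attains_sup[OF compact_cball, of 0 R "\<lambda>x. u x / \<phi> x"] \<open>0 < R\<close> by auto
  define M where "M = u x0 / \<phi> x0"
  have ux0: "u x0 = M * \<phi> x0" using \<phi>[OF x0] by (simp add: M_def)
  have "0 < u y / \<phi> y" using uy \<phi>[OF y] by simp
  then have M: "0 < M" using sup[OF y] by (simp add: M_def)
  have le: "u x \<le> M * \<phi> x" if "x \<in> cball 0 R" for x
    using sup[OF that] \<phi>[OF that] by (simp add: M_def[symmetric] field_simps)
  show False
  proof (cases "x0 \<in> ball 0 R")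
    case True
    obtain e where e: "0 < e" "ball x0 e \<subseteq> ball 0 R"
      using True open_ball open_contains_ball by metis
    define s where "s = \<kappa> * (norm x0)\<^sup>2"
    have Hb: "H x0 b \<bullet> b \<le> M * (4 * \<kappa>\<^sup>2 * ?G (\<nu> + 2) s * (x0 \<bullet> b)\<^sup>2 - 2 * \<kappa> * ?G (\<nu> + 1) s)"
      if b: "b \<in> Basis" for b
    proof -
      \<comment> \<open>This is kappa |x0 + t b|^2 for the unit vector b.\<close>
      define q where "q t = \<kappa> * ((norm x0)\<^sup>2 + 2 * t * (x0 \<bullet> b) + t\<^sup>2)" for t
      have "(norm (x0 + t *\<^sub>R b))\<^sup>2 = (norm x0)\<^sup>2 + 2 * t * (x0 \<bullet> b) + t\<^sup>2" for t
        unfolding power2_norm_eq_inner using b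
        by (simp add: inner_simps inner_commute power2_eq_square algebra_simps)
      then have q: "\<phi> (x0 + t *\<^sub>R b) = ?G \<nu> (q t)" for t
        by (simp add: \<phi>_def q_def)
      have in_ball: "x0 + t *\<^sub>R b \<in> ball 0 R" if "\<bar>t\<bar> < e" for t
        using e(2) b that by (intro subsetD[OF e(2)]) (simp add: dist_norm)
      define f where "f t = u (x0 + t *\<^sub>R b) - M * ?G \<nu> (q t)" for t
      define f' where "f' t = g (x0 + t *\<^sub>R b) \<bullet> b + M * ?G (\<nu> + 1) (q t) * (\<kappa> * (2 * (x0 \<bullet> b) + 2 * t))" for t
      have dq: "(q has_real_derivative \<kappa> * (2 * (x0 \<bullet> b) + 2 * t)) (at t)" for t
        unfolding q_def[abs_def] by (auto intro!: derivative_eq_intros simp: algebra_simps)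
      \<comment> \<open>The left side is the second derivative of u - M phi along b at its maximum
        point x0, where it vanishes.\<close>
      have "H x0 b \<bullet> b - M * (4 * \<kappa>\<^sup>2 * ?G (\<nu> + 2) s * (x0 \<bullet> b)\<^sup>2 - 2 * \<kappa> * ?G (\<nu> + 1) s) \<le> 0"
      proof (rule second_derivative_local_max[OF e(1)])
        show "f t \<le> f 0" if "\<bar>t\<bar> < e" for t
        proof -
          have "x0 + t *\<^sub>R b \<in> cball 0 R" using in_ball[OF that] by simp
          from le[OF this] have "f t \<le> 0" by (simp add: f_def q)
          also have "0 = f 0" using q[of 0] ux0 by (simp add: f_def)
          finally show ?thesis .
        qed
        show "(f has_real_derivative f' t) (at t)" if "\<bar>t\<bar> < e" for t
          unfolding f_def[abs_def] f'_def
          using gradient_on_line_derivative[OF u(1) in_ball[OF that]] dq[of t] \<nu>(2)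
          by (auto intro!: derivative_eq_intros)
        have g0: "((\<lambda>t. g (x0 + t *\<^sub>R b) \<bullet> b) has_real_derivative H x0 b \<bullet> b) (at 0)"
          using inner_line_derivative[of g "H x0" x0 0 b] H[OF True] by simp
        have q0: "q 0 = s" by (simp add: q_def s_def)
        have "(f' has_real_derivative H x0 b \<bullet> b + (M * (- ?G (\<nu> + 2) (q 0) * (\<kappa> * (2 * (x0 \<bullet> b))))
            * (\<kappa> * (2 * (x0 \<bullet> b))) + M * ?G (\<nu> + 1) (q 0) * (\<kappa> * 2))) (at 0)"
          unfolding f'_def[abs_def] using g0 dq[of 0] \<nu>(2)
          by (auto intro!: derivative_eq_intros simp: add_ac)
        then show "(f' has_real_derivative H x0 b \<bullet> b
            - M * (4 * \<kappa>\<^sup>2 * ?G (\<nu> + 2) s * (x0 \<bullet> b)\<^sup>2 - 2 * \<kappa> * ?G (\<nu> + 1) s)) (at 0)"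
          unfolding q0 by (simp add: algebra_simps power2_eq_square)
      qed
      then show ?thesis by simp
    qed
    have norm: "(\<Sum>b\<in>Basis. (x0 \<bullet> b)\<^sup>2) = (norm x0)\<^sup>2"
      unfolding power2_norm_eq_inner euclidean_inner[of x0 x0] by (simp add: power2_eq_square)
    have "- (lam * u x0) = (\<Sum>b\<in>Basis. H x0 b \<bullet> b)" using eq[OF True] by simp
    also have "\<dots> \<le> (\<Sum>b\<in>Basis. M * (4 * \<kappa>\<^sup>2 * ?G (\<nu> + 2) s * (x0 \<bullet> b)\<^sup>2 - 2 * \<kappa> * ?G (\<nu> + 1) s))"
      by (intro sum_mono Hb)
    also have "\<dots> = M * (4 * \<kappa>\<^sup>2 * ?G (\<nu> + 2) s * (norm x0)\<^sup>2 - 2 * \<kappa> * ?G (\<nu> + 1) s * real DIM('a))"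
      by (simp add: sum_distrib_left[symmetric] sum_subtractf norm)
    \<comment> \<open>The dimension is 2 (nu + 1), exactly what turns the trace into the right side
      of the recurrence for G_nu.\<close>
    also have "\<dots> = - 4 * \<kappa> * M * ((\<nu> + 1) * ?G (\<nu> + 1) s - s * ?G (\<nu> + 2) s)"
    proof -
      have "real DIM('a) = 2 * (\<nu> + 1)" using \<nu>(1) by simp
      then show ?thesis by (simp only: s_def) (simp add: algebra_simps power2_eq_square)
    qed
    also have "\<dots> = - 4 * \<kappa> * u x0"
      using bessel_entire_recurrence[OF \<nu>(2), of s] by (simp add: ux0 \<phi>_def s_def)
    finally have "(4 * \<kappa> - lam) * u x0 \<le> 0" by (simp add: algebra_simps)
    moreover have "0 < u x0" using M \<phi>[OF x0] by (simp add: ux0)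
    ultimately show False using \<open>lam < 4 * \<kappa>\<close> by (simp add: mult_le_0_iff)
  next
    case False
    then have nx0: "norm x0 = R" using x0 by simp
    define s where "s = \<kappa> * R\<^sup>2"
    \<comment> \<open>u - M phi along the ray from the origin to x0. As x0 is R times the outer
      normal, \<open>F 1\<close> is R times the normal derivative.\<close>
    define f where "f t = u (t *\<^sub>R x0) - M * ?G \<nu> (s * t\<^sup>2)" for t
    define F where "F t = g2 (t *\<^sub>R x0) \<bullet> x0 + M * ?G (\<nu> + 1) (s * t\<^sup>2) * (2 * s * t)" for t
    have \<phi>t: "\<phi> (t *\<^sub>R x0) = ?G \<nu> (s * t\<^sup>2)" for t
      by (simp add: \<phi>_def s_def nx0 power_mult_distrib mult_ac)
    have seg: "(\<lambda>t. t *\<^sub>R x0) ` {0..1} \<subseteq> cball 0 R"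
      using nx0 \<open>0 < R\<close> by (auto simp: abs_mult mult_left_le_one_le)
    have "0 \<le> F 1"
    proof (rule end_derivative_nonneg[where a = 0 and f = f and F = F])
      show "continuous_on {0..1} f"
        unfolding f_def by (intro continuous_intros continuous_on_compose2[OF u(2) _ seg] \<nu>(2))
      show "continuous_on {0..1} F"
        unfolding F_def using \<nu>(2) by (intro continuous_intros continuous_on_compose2[OF g2(2) _ seg]) auto
      fix t :: real
      show "(f has_real_derivative F t) (at t)" if t: "0 < t" "t < 1"
      proof -
        have "t *\<^sub>R x0 \<in> ball 0 R" using t nx0 \<open>0 < R\<close> by simp
        then show ?thesis
          unfolding f_def[abs_def] F_def
          using gradient_on_line_derivative[OF g2(1), of 0 t x0] \<nu>(2)
          by (auto intro!: derivative_eq_intros)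
      qed
      show "f t \<le> f 1" if t: "0 \<le> t" "t \<le> 1"
      proof -
        have "t *\<^sub>R x0 \<in> cball 0 R" by (rule subsetD[OF seg imageI]) (use t in simp)
        from le[OF this] have "f t \<le> 0" by (simp add: f_def \<phi>t)
        also have "0 = f 1" using \<phi>t[of 1] ux0 by (simp add: f_def)
        finally show ?thesis .
      qed
    qed simp
    moreover have "g2 x0 \<bullet> x0 = - (\<alpha> * R * u x0)"
      using bc[of x0] nx0 \<open>0 < R\<close> by (simp add: field_simps)
    moreover have "u x0 = M * ?G \<nu> s" using ux0 \<phi>t[of 1] by simp
    \<comment> \<open>By the boundary condition \<open>F 1\<close> equals -M D_0(s).\<close>
    ultimately have "M * robin_entire (\<alpha> * R) \<nu> 0 s \<le> 0"
      by (simp add: F_def robin_entire_def algebra_simps)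
    then show False using M posD by (simp add: s_def mult_le_0_iff)
  qed
qed

lemma no_robin_eigenvalue_below:
  fixes R \<alpha> kc lam :: real
  assumes d: "DIM('a::euclidean_space) = d" "2 \<le> d" and "0 < R" "0 < \<alpha>"
    and band: "positivity_band d R \<alpha> kc" and lam: "0 < lam" "lam < kc\<^sup>2"
  shows "\<not> robin_eigenvalue TYPE('a) R \<alpha> lam"
proof
  assume "robin_eigenvalue TYPE('a) R \<alpha> lam"
  then obtain u :: "'a \<Rightarrow> real" where "robin_eigenfunction R \<alpha> lam u"
    by (auto simp: robin_eigenvalue_def)
  \<comment> \<open>Two gradients appear: \<open>g\<close> is differentiable inside,
    \<open>g2\<close> extends to the closed ball. They agree in the open ball, but each serves only
    one case of the comparison.\<close>
  then obtain g H g2 x where g: "gradient_on u (ball 0 R) g"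
    and H: "\<And>x. x \<in> ball 0 R \<Longrightarrow> (g has_derivative blinfun_apply (H x)) (at x)"
    and u: "continuous_on (cball 0 R) u" "\<And>x. x \<in> ball 0 R \<Longrightarrow> - laplacian u x = lam * u x"
    and g2: "gradient_on u (ball 0 R) g2" "continuous_on (cball 0 R) g2"
    and bc: "\<And>x. x \<in> sphere 0 R \<Longrightarrow> g2 x \<bullet> (x /\<^sub>R R) + \<alpha> * u x = 0"
    and x: "x \<in> ball 0 R" "u x \<noteq> 0"
    unfolding robin_eigenfunction_def C2_on_def by blast
  define \<nu> where "\<nu> = real d / 2 - 1"
  have \<nu>: "0 \<le> \<nu>" using d by (simp add: \<nu>_def)
  have kc: "0 < kc" using band by (simp add: positivity_band_def)
  have "sqrt lam < kc" using lam kc by (simp add: real_less_lsqrt)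
  \<comment> \<open>The gap between sqrt lam and \<open>kc\<close> makes both inequalities strict:
    lam < 4 kappa inside, D_0 > 0 on the sphere.\<close>
  then obtain k where k: "sqrt lam < k" "k < kc" using dense by blast
  have k0: "0 < k" using k(1) lam by (meson order_less_trans real_sqrt_gt_zero)
  define \<kappa> where "\<kappa> = k\<^sup>2 / 4"
  have "(sqrt lam)\<^sup>2 < k\<^sup>2" using k(1) lam by (intro power_strict_mono) auto
  then have \<kappa>: "0 < \<kappa>" "lam < 4 * \<kappa>" using k0 lam by (simp_all add: \<kappa>_def)
  have pos0: "0 < robin_entire (\<alpha> * R) \<nu> 0 s" if s: "0 < s" "s \<le> \<kappa> * R\<^sup>2" for s
  proof -
    define k' where "k' = 2 * sqrt s / R"
    have k': "(k' * R)\<^sup>2 / 4 = s" "0 < k'" using s \<open>0 < R\<close> by (simp_all add: k'_def power_mult_distrib)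
    have "(k' * R)\<^sup>2 \<le> (k * R)\<^sup>2" using k' s by (simp add: \<kappa>_def power_mult_distrib)
    then have "k' * R \<le> k * R"
      by (rule power2_le_imp_le) (use k0 \<open>0 < R\<close> in simp)
    then have "k' < kc" using k \<open>0 < R\<close> by simp
    then have "0 < robin_Delta d R \<alpha> 0 k'"
      using band k' by (simp add: positivity_band_def)
    then show ?thesis
      using robin_Delta_pos_iff[of d R k' \<alpha> 0] d \<open>0 < R\<close> k' by (simp add: \<nu>_def)
  qed
  have posG: "0 < bessel_entire \<nu> s" if "0 \<le> s" "s \<le> \<kappa> * R\<^sup>2" for s
  proof (cases "s = 0")
    case True
    then show ?thesis using \<nu> by (simp add: bessel_entire_0)
  next
    case False
    then show ?thesis
      using that \<open>0 < R\<close> \<open>0 < \<alpha>\<close> \<nu> pos0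
      by (intro bessel_entire_pos_base[where \<beta> = "\<alpha> * R" and S = "\<kappa> * R\<^sup>2"]) auto
  qed
  have posD: "0 < robin_entire (\<alpha> * R) \<nu> 0 (\<kappa> * R\<^sup>2)"
    using pos0 \<kappa> \<open>0 < R\<close> by simp
  have eq: "- (\<Sum>b\<in>Basis. H x b \<bullet> b) = lam * u x" if "x \<in> ball 0 R" for x
    using u(2)[OF that] laplacian_eq_trace[OF g open_ball that H[OF that]] by simp
  have \<nu>': "\<nu> = real DIM('a) / 2 - 1" using d by (simp add: \<nu>_def)
  have xc: "x \<in> cball 0 R" using x by simp
  note common = \<nu>' \<nu> \<open>0 < R\<close> \<kappa> posG posD
  have "u x \<le> 0"
    by (rule robin_comparison_principle[OF common g u(1) H eq g2 bc xc])
  \<comment> \<open>The principle is one-sided; by linearity it applies to -u as well, so u vanishes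
    at \<open>x\<close>.\<close>
  moreover have "- u x \<le> 0"
  proof (rule robin_comparison_principle[OF common, where u = "\<lambda>x. - u x" and g = "\<lambda>x. - g x"
        and H = "\<lambda>x h. - H x h" and ?g2.0 = "\<lambda>x. - g2 x"])
    show "gradient_on (\<lambda>x. - u x) (ball 0 R) (\<lambda>x. - g x)"
      "gradient_on (\<lambda>x. - u x) (ball 0 R) (\<lambda>x. - g2 x)"
      using g g2(1) by (auto simp: gradient_on_def intro: has_derivative_minus)
    show "continuous_on (cball 0 R) (\<lambda>x. - u x)" "continuous_on (cball 0 R) (\<lambda>x. - g2 x)"
      using u(1) g2(2) by (auto intro: continuous_on_minus)
    show "((\<lambda>x. - g x) has_derivative (\<lambda>h. - H x h)) (at x)" if "x \<in> ball 0 R" for x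
      using H[OF that] by (rule has_derivative_minus)
    show "- (\<Sum>b\<in>Basis. - H x b \<bullet> b) = lam * - u x" if "x \<in> ball 0 R" for x
      using eq[OF that] by (simp add: sum_negf)
    show "- g2 x \<bullet> (x /\<^sub>R R) + \<alpha> * - u x = 0" if "x \<in> sphere 0 R" for x
      using bc[OF that] by simp
  qed (use xc in auto)
  ultimately show False using x by simp
qed

text \<open>The last clause makes the truncation precise: one remainder, depending on beta alone,
  holds for all radii and impedances, and the formula for \<open>kc\<close> is exact once
  \<open>\<rho> \<beta> / r\<^sup>2\<close> is kept under the root. The range beta < d + 2 is where
  the truncated radicand is positive.\<close>

theorem theorem4:
  fixes d :: nat and \<nu> R \<alpha> :: real
  assumes "CARD('n::finite) = d" and "2 \<le> d" and "\<nu> = real d / 2 - 1"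
    and "0 < R" and "0 < \<alpha>"
  shows
    "(\<exists>\<rho> \<in> O[at_right 0](\<lambda>k. k ^ 6). \<forall>k>0.
        robin_Delta d R \<alpha> 0 k =
          (k * R / 2) powr \<nu> / Gamma (\<nu> + 1) *
          (\<alpha> - (\<alpha> + 2 / R) / (4 * (\<nu> + 1)) * (k * R) ^ 2
             + (\<alpha> * R + 4) / (32 * R * (\<nu> + 1) * (\<nu> + 2)) * (k * R) ^ 4 + \<rho> k))
     \<and>
     (\<forall>l\<ge>1. let \<mu> = real l + \<nu> in
        (\<lambda>k. robin_Delta d R \<alpha> l k
              - R powr \<mu> / (2 powr \<mu> * Gamma (\<mu> + 1)) * (\<alpha> + real l / R) * k powr \<mu>)
          \<in> O[at_right 0](\<lambda>k. k powr (\<mu> + 2)))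
     \<and>
     (\<exists>kc>0. \<forall>k l. 0 < k \<and> k < kc \<longrightarrow> 0 < robin_Delta d R \<alpha> l k)
     \<and>
     (\<forall>kc. positivity_band d R \<alpha> kc \<longrightarrow>
        (\<forall>lam. 0 < lam \<and> lam < kc\<^sup>2 \<longrightarrow> \<not> robin_eigenvalue TYPE(real ^ 'n) R \<alpha> lam) \<and>
        (\<forall>k. 0 < k \<and> k < kc \<longrightarrow> \<not> resonant_wavenumber d R \<alpha> k))
     \<and>
     (let kc = critical_wavenumber d R \<alpha> in
        positivity_band d R \<alpha> kc \<and> (\<forall>K. positivity_band d R \<alpha> K \<longrightarrow> K \<le> kc) \<and>
        resonant_wavenumber d R \<alpha> kc \<and> (\<forall>k. resonant_wavenumber d R \<alpha> k \<longrightarrow> kc \<le> k))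
     \<and>
     (\<exists>\<rho> \<in> O[at_right 0](\<lambda>\<beta>. \<beta> ^ 3). \<forall>r>0. \<forall>a>0.
        let kc = critical_wavenumber d r a; \<beta> = a * r; xc = kc * r in
          xc\<^sup>2 = real d * \<beta> - real d / (real d + 2) * \<beta>\<^sup>2 + \<rho> \<beta> \<and>
          (\<beta> < real d + 2 \<longrightarrow>
             0 < real d * a / r * (1 - a * r / (real d + 2)) \<and>
             kc = sqrt (real d * a / r * (1 - a * r / (real d + 2)) + \<rho> \<beta> / r\<^sup>2)))"
proof -
  have \<nu>0: "0 \<le> \<nu>" using assms by simp
  \<comment> \<open>A first zero is chosen for every beta, not only for alpha R, since the expansion
    concerns the whole family.\<close>
  have "\<forall>\<beta>\<in>{0<..}. \<exists>s>0. robin_entire \<beta> \<nu> 0 s = 0 \<and>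
      (\<forall>t. 0 < t \<and> t < s \<longrightarrow> 0 < robin_entire \<beta> \<nu> 0 t)"
    using robin_entire_first_zero[OF _ \<nu>0] by simp
  from bchoice[OF this] obtain z where z: "\<And>\<beta>. 0 < \<beta> \<Longrightarrow> 0 < z \<beta>"
      "\<And>\<beta>. 0 < \<beta> \<Longrightarrow> robin_entire \<beta> \<nu> 0 (z \<beta>) = 0"
      "\<And>\<beta> t. 0 < \<beta> \<Longrightarrow> 0 < t \<Longrightarrow> t < z \<beta> \<Longrightarrow> 0 < robin_entire \<beta> \<nu> 0 t"
    by auto
  have z_pos: "0 < z (a * r)" if "0 < r" "0 < a" for a r
    using z(1) that by simp
  note crit = critical_wavenumber_of_first_zero[OF \<open>2 \<le> d\<close> _ _ \<open>\<nu> = real d / 2 - 1\<close> z_pos z(2,3)]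
  have crit_eq: "critical_wavenumber d r a = 2 * sqrt (z (a * r)) / r" if "0 < r" "0 < a" for a r
    using that by (intro crit(1)) auto
  have item3: "positivity_band d R \<alpha> (critical_wavenumber d R \<alpha>) \<and>
      (\<forall>K. positivity_band d R \<alpha> K \<longrightarrow> K \<le> critical_wavenumber d R \<alpha>) \<and>
      resonant_wavenumber d R \<alpha> (critical_wavenumber d R \<alpha>) \<and>
      (\<forall>k. resonant_wavenumber d R \<alpha> k \<longrightarrow> critical_wavenumber d R \<alpha> \<le> k)"
    unfolding crit_eq[OF \<open>0 < R\<close> \<open>0 < \<alpha>\<close>]
    using crit(2-5)[where R = R and \<alpha> = \<alpha>] \<open>0 < R\<close> \<open>0 < \<alpha>\<close> by simp
  define \<rho> where "\<rho> \<beta> = 4 * z \<beta> - (real d * \<beta> - real d / (real d + 2) * \<beta>\<^sup>2)" for \<beta>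
  have "2 * (\<nu> + 1) = real d" "(\<nu> + 1) / (\<nu> + 1 + 1) = real d / (real d + 2)"
    using assms by (simp_all add: field_simps)
  then have \<rho>: "\<rho> \<in> O[at_right 0](\<lambda>\<beta>. \<beta> ^ 3)"
    using robin_entire_first_zero_asymptotics[OF \<nu>0 z] by (simp only: \<rho>_def[abs_def])
  have item5: "let kc = critical_wavenumber d r a; \<beta> = a * r; xc = kc * r in
          xc\<^sup>2 = real d * \<beta> - real d / (real d + 2) * \<beta>\<^sup>2 + \<rho> \<beta> \<and>
          (\<beta> < real d + 2 \<longrightarrow>
             0 < real d * a / r * (1 - a * r / (real d + 2)) \<and>
             kc = sqrt (real d * a / r * (1 - a * r / (real d + 2)) + \<rho> \<beta> / r\<^sup>2))"
    if r: "0 < r" and a: "0 < a" for r a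
  proof -
    define k where "k = critical_wavenumber d r a"
    have "0 < k" using crit_eq[OF r a] z_pos[OF r a] r by (simp add: k_def)
    have xc: "(k * r)\<^sup>2 = 4 * z (a * r)"
      using crit_eq[OF r a] z_pos[OF r a] r by (simp add: k_def power_mult_distrib)
    have "real d * a / r * (1 - a * r / (real d + 2)) + \<rho> (a * r) / r\<^sup>2 = 4 * z (a * r) / r\<^sup>2"
      using r by (simp add: \<rho>_def divide_simps) (simp add: algebra_simps power2_eq_square)
    also have "\<dots> = k\<^sup>2" unfolding xc[symmetric] using r by (simp add: power_mult_distrib)
    finally have "k = sqrt (real d * a / r * (1 - a * r / (real d + 2)) + \<rho> (a * r) / r\<^sup>2)"
      using \<open>0 < k\<close> by simp
    moreover have "0 < real d * a / r * (1 - a * r / (real d + 2))" if "a * r < real d + 2"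
      using that r a \<open>2 \<le> d\<close> by (intro mult_pos_pos divide_pos_pos) auto
    ultimately show ?thesis
      unfolding Let_def k_def[symmetric] xc by (simp add: \<rho>_def)
  qed
  have item2: "\<exists>kc>0. \<forall>k l. 0 < k \<and> k < kc \<longrightarrow> 0 < robin_Delta d R \<alpha> l k"
    using item3 by (auto simp: positivity_band_def)
  have item4: "(\<forall>lam. 0 < lam \<and> lam < kc\<^sup>2 \<longrightarrow> \<not> robin_eigenvalue TYPE(real ^ 'n) R \<alpha> lam) \<and>
        (\<forall>k. 0 < k \<and> k < kc \<longrightarrow> \<not> resonant_wavenumber d R \<alpha> k)"
    if "positivity_band d R \<alpha> kc" for kc
  proof (intro conjI allI impI)
    show "\<not> robin_eigenvalue TYPE(real ^ 'n) R \<alpha> lam" if "0 < lam \<and> lam < kc\<^sup>2" for lam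
      using no_robin_eigenvalue_below[where 'a = "real ^ 'n", of d R \<alpha> kc lam]
        \<open>positivity_band d R \<alpha> kc\<close> that assms by simp
    show "\<not> resonant_wavenumber d R \<alpha> k" if "0 < k \<and> k < kc" for k
      using \<open>positivity_band d R \<alpha> kc\<close> that
      unfolding positivity_band_def resonant_wavenumber_def by (metis less_irrefl)
  qed
  have item1: "let \<mu> = real l + \<nu> in
        (\<lambda>k. robin_Delta d R \<alpha> l k
              - R powr \<mu> / (2 powr \<mu> * Gamma (\<mu> + 1)) * (\<alpha> + real l / R) * k powr \<mu>)
          \<in> O[at_right 0](\<lambda>k. k powr (\<mu> + 2))" for l
    unfolding Let_def using robin_Delta_asymptotics[of d R \<alpha> "real l + \<nu>" l] assms by simp
  have "\<exists>\<rho> \<in> O[at_right 0](\<lambda>\<beta>. \<beta> ^ 3). \<forall>r>0. \<forall>a>0.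
        let kc = critical_wavenumber d r a; \<beta> = a * r; xc = kc * r in
          xc\<^sup>2 = real d * \<beta> - real d / (real d + 2) * \<beta>\<^sup>2 + \<rho> \<beta> \<and>
          (\<beta> < real d + 2 \<longrightarrow>
             0 < real d * a / r * (1 - a * r / (real d + 2)) \<and>
             kc = sqrt (real d * a / r * (1 - a * r / (real d + 2)) + \<rho> \<beta> / r\<^sup>2))"
    by (intro bexI[OF _ \<rho>] allI impI item5)
  then show ?thesis
    using robin_Delta_0_asymptotics[OF \<open>2 \<le> d\<close> \<open>0 < R\<close> \<open>0 < \<alpha>\<close> \<open>\<nu> = real d / 2 - 1\<close>]
      item1 item2 item3 item4
    unfolding Let_def[of "critical_wavenumber d R \<alpha>"] by (intro conjI allI impI; (assumption | simp))
qed

end
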